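(* There exists a sequence $A=(A_n)_{n\in\mathbb{N}}$ of square complex matrices with eigenvalues in the open unit disc $\mathbb{D}$ such that the associated sequence of model spaces $(H_n)_{n\in\mathbb{N}}$, $H_n=\mathrm{H}^2\ominus\{f\in\mathrm{H}^2 : f(A_n)=0\}$, is a Bessel system, but $(H_n)_{n\in\mathbb{N}}$ cannot be written as the disjoint union of finitely many weakly separated sequences. In particular, $(H_n)_{n\in\mathbb{N}}$ is a Bessel system of model spaces of $\mathrm{H}^2$ which is not the disjoint union of finitely many Riesz systems.
   Context: $\mathrm{H}^2$ is the Hardy space on the unit disc $\mathbb{D}$ (power series centered at $0$ with square-summable Taylor coefficients, with the $\ell^2$ inner product of the coefficients). Holomorphic functions on $\mathbb{D}$ are applied to square matrices with spectrum in $\mathbb{D}$ through the Riesz–Dunford functional calculus. A model space is a space of the form $\mathrm{H}^2\ominus\Theta\mathrm{H}^2$ with $\Theta$ an inner function; $H_n$ is the model space of the finite Blaschke product whose zeros are the eigenvalues of $A_n$, each with multiplicity equal to its multiplicity as a root of the minimal polynomial of $A_n$. For closed subspaces $K_1,K_2$ of a Hilbert space, $\sin(K_1,K_2)$ is the infimum of the sines of the angles between a nonzero vector of $K_1$ and a nonzero vector of $K_2$; equivalently $\sin(K_1,K_2)=\inf\{\mathrm{dist}(x,K_2): x\in K_1,\ \|x\|=1\}$. A finite or countable family $(H_n)_{n\in I}$ of closed subspaces of a Hilbert space is: - weakly separated if $\inf_{n\neq j}\sin(H_n,H_j)>0$; - a Bessel system if there is a finite constant $C\ge1$ such that, for every choice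 of unit vectors $h_n\in H_n$ ($n\in I$) and every $(a_n)_{n\in I}\in\ell^2(I)$, $\left\|\sum_n a_nh_n\right\|^2\le C^2\sum_n|a_n|^2$; - a Riesz system if there is a finite constant $C\geq1$ such that, for every choice of unit vectors $h_n\in H_n$ and every $(a_n)\in\ell^2(I)$, $\frac{1}{C^2}\sum_n|a_n|^2\le\left\|\sum_n a_nh_n\right\|^2\le C^2\sum_n|a_n|^2$. "$(H_n)_{n\in\mathbb{N}}$ is the disjoint union of finitely many sequences with a property" means that there is a partition of the index set $\mathbb{N}$ into finitely many subsets $I_1,\dots,I_k$ such that each $(H_n)_{n\in I_i}$ has the property. *)

theory Defs
  imports
    "HOL-Complex_Analysis.Complex_Analysis"
    "HOL-Library.Disjoint_Sets"
    "Jordan_Normal_Form.Spectral_Radius"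
    "Jordan_Normal_Form.Gauss_Jordan_Elimination"
begin

hide_const (open) Determinants.det Finite_Cartesian_Product.mat

section \<open>The Hardy space\<close>

text \<open>
  Power series are not used with the \<open>X\<close>-adic topology of \<^typ>\<open>complex fps\<close>: the new type
  carries the norm and topology given by the square-summable coefficients.
\<close>

typedef hardy = "{f :: complex fps. summable (\<lambda>n. (cmod (fps_nth f n))\<^sup>2)}"
  morphisms series Hardy
  by (rule exI[of _ 0]) simp

setup_lifting type_definition_hardy

lemma summable_series: "summable (\<lambda>n. (cmod (fps_nth (series f) n))\<^sup>2)"
  using series by blast

lemma summable_sq_add:
  fixes a b :: "nat \<Rightarrow> complex"
  assumes "summable (\<lambda>n. (cmod (a n))\<^sup>2)" "summable (\<lambda>n. (cmod (b n))\<^sup>2)"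
  shows "summable (\<lambda>n. (cmod (a n + b n))\<^sup>2)"
proof (rule summable_comparison_test'[where N = 0])
  show "summable (\<lambda>n. 2 * (cmod (a n))\<^sup>2 + 2 * (cmod (b n))\<^sup>2)"
    by (intro summable_add summable_mult assms)
next
  fix n :: nat
  have "(cmod (a n + b n))\<^sup>2 \<le> (cmod (a n) + cmod (b n))\<^sup>2"
    by (intro power_mono norm_triangle_ineq) auto
  also have "\<dots> \<le> 2 * (cmod (a n))\<^sup>2 + 2 * (cmod (b n))\<^sup>2"
    using sum_squares_bound[of "cmod (a n)" "cmod (b n)"] by (simp add: power2_sum)
  finally show "norm ((cmod (a n + b n))\<^sup>2) \<le> 2 * (cmod (a n))\<^sup>2 + 2 * (cmod (b n))\<^sup>2"
    by simp
qed

lemma summable_sq_mult: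
  fixes c :: complex
  assumes "summable (\<lambda>n. (cmod (a n))\<^sup>2)"
  shows "summable (\<lambda>n. (cmod (c * a n))\<^sup>2)"
  using summable_mult[OF assms, of "(cmod c)\<^sup>2"] by (simp add: norm_mult power_mult_distrib)

lemma summable_cnj_prod:
  fixes a b :: "nat \<Rightarrow> complex"
  assumes "summable (\<lambda>n. (cmod (a n))\<^sup>2)" "summable (\<lambda>n. (cmod (b n))\<^sup>2)"
  shows "summable (\<lambda>n. a n * cnj (b n))"
proof (rule summable_comparison_test'[where N = 0])
  show "summable (\<lambda>n. (cmod (a n))\<^sup>2 + (cmod (b n))\<^sup>2)"
    by (intro summable_add assms)
next
  fix n :: nat
  have "2 * (cmod (a n) * cmod (b n)) \<le> (cmod (a n))\<^sup>2 + (cmod (b n))\<^sup>2"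
    using sum_squares_bound[of "cmod (a n)" "cmod (b n)"] by simp
  moreover have "0 \<le> cmod (a n) * cmod (b n)" by simp
  ultimately show "norm (a n * cnj (b n)) \<le> (cmod (a n))\<^sup>2 + (cmod (b n))\<^sup>2"
    by (simp only: norm_mult complex_mod_cnj)
qed

lift_definition scaleC :: "complex \<Rightarrow> hardy \<Rightarrow> hardy" (infixr "*\<^sub>C" 75)
  is "\<lambda>c f. fps_const c * f"
  by (auto intro: summable_sq_mult)

definition cinner :: "hardy \<Rightarrow> hardy \<Rightarrow> complex" where
  "cinner f g = (\<Sum>n. fps_nth (series f) n * cnj (fps_nth (series g) n))"

lemma sums_cinner:
  "(\<lambda>n. fps_nth (series f) n * cnj (fps_nth (series g) n)) sums cinner f g"
  unfolding cinner_def by (intro summable_sums summable_cnj_prod summable_series)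

instantiation hardy :: real_inner
begin

lift_definition zero_hardy :: hardy is 0 by simp
lift_definition plus_hardy :: "hardy \<Rightarrow> hardy \<Rightarrow> hardy" is "(+)"
  by (auto intro: summable_sq_add)
lift_definition uminus_hardy :: "hardy \<Rightarrow> hardy" is uminus by simp
definition minus_hardy :: "hardy \<Rightarrow> hardy \<Rightarrow> hardy" where
  "minus_hardy f g = f + - g"
definition scaleR_hardy :: "real \<Rightarrow> hardy \<Rightarrow> hardy" where
  "scaleR_hardy c f = complex_of_real c *\<^sub>C f"
definition inner_hardy :: "hardy \<Rightarrow> hardy \<Rightarrow> real" where
  "inner_hardy f g = Re (cinner f g)"
definition norm_hardy :: "hardy \<Rightarrow> real" where
  "norm_hardy f = sqrt (inner f f)"
definition sgn_hardy :: "hardy \<Rightarrow> hardy" where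
  "sgn_hardy f = inverse (norm f) *\<^sub>R f"
definition dist_hardy :: "hardy \<Rightarrow> hardy \<Rightarrow> real" where
  "dist_hardy f g = norm (f - g)"
definition uniformity_hardy :: "(hardy \<times> hardy) filter" where
  "uniformity_hardy = (INF e\<in>{0<..}. principal {(x, y). dist x y < e})"
definition open_hardy :: "hardy set \<Rightarrow> bool" where
  "open_hardy U \<longleftrightarrow> (\<forall>x\<in>U. \<forall>\<^sub>F (x', y) in uniformity. x' = x \<longrightarrow> y \<in> U)"

instance
proof
  fix f g h :: hardy and a b :: real
  show "f + g + h = f + (g + h)" "f + g = g + f" "0 + f = f" "- f + f = 0"
    by (transfer; simp add: algebra_simps)+
  show "f - g = f + - g" by (rule minus_hardy_def)
  show "a *\<^sub>R (f + g) = a *\<^sub>R f + a *\<^sub>R g" "(a + b) *\<^sub>R f = a *\<^sub>R f + b *\<^sub>R f"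
    "a *\<^sub>R b *\<^sub>R f = (a * b) *\<^sub>R f" "1 *\<^sub>R f = f"
    unfolding scaleR_hardy_def
    by (transfer; simp add: algebra_simps flip: fps_const_add fps_const_mult)+
  show "dist f g = norm (f - g)" by (rule dist_hardy_def)
  show "sgn f = inverse (norm f) *\<^sub>R f" by (rule sgn_hardy_def)
  show "uniformity = (INF e\<in>{0<..}. principal {(x, y :: hardy). dist x y < e})"
    by (rule uniformity_hardy_def)
  show "open U \<longleftrightarrow> (\<forall>x\<in>U. \<forall>\<^sub>F (x', y) in uniformity. x' = x \<longrightarrow> y \<in> U)" for U :: "hardy set"
    by (rule open_hardy_def)
  show "norm f = sqrt (inner f f)" by (rule norm_hardy_def)
  have cnj_cinner: "cinner f g = cnj (cinner g f)"
    using sums_cinner[of g f] sums_cinner[of f g]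
    by (auto simp: sums_cnj[of _ "cinner g f", symmetric] intro!: sums_unique2 simp: mult.commute)
  show "inner f g = inner g f"
    unfolding inner_hardy_def using arg_cong[OF cnj_cinner, of Re] by simp
  have "cinner (f + g) h = cinner f h + cinner g h"
    by (rule sums_unique2[OF sums_cinner])
      (use sums_add[OF sums_cinner[of f h] sums_cinner[of g h]]
        in \<open>simp add: plus_hardy.rep_eq algebra_simps\<close>)
  then show "inner (f + g) h = inner f h + inner g h"
    by (simp add: inner_hardy_def)
  have "cinner (a *\<^sub>R f) g = of_real a * cinner f g"
    by (rule sums_unique2[OF sums_cinner])
      (use sums_mult[OF sums_cinner[of f g], of "of_real a"]
        in \<open>simp add: scaleR_hardy_def scaleC.rep_eq mult.assoc\<close>)
  then show "inner (a *\<^sub>R f) g = a * inner f g"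
    by (simp add: inner_hardy_def)
  have sq: "(\<lambda>n. (cmod (fps_nth (series f) n))\<^sup>2) sums inner f f"
    using sums_Re[OF sums_cinner[of f f]]
    by (simp add: inner_hardy_def complex_mult_cnj cmod_power2)
  show "0 \<le> inner f f"
    by (rule sums_le[OF _ sums_zero sq]) simp
  show "inner f f = 0 \<longleftrightarrow> f = 0"
  proof
    assume "inner f f = 0"
    with sq have "\<forall>n. (cmod (fps_nth (series f) n))\<^sup>2 = 0"
      using suminf_eq_zero_iff[OF summable_series[of f]] sums_unique[OF sq] by simp
    then have "series f = 0" by (intro fps_ext) simp
    then show "f = 0" by (metis series_inverse zero_hardy.rep_eq)
  next
    assume "f = 0"
    then show "inner f f = 0" by (simp add: inner_hardy_def cinner_def zero_hardy.rep_eq)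
  qed
qed

end

definition orth_compl :: "hardy set \<Rightarrow> hardy set" where
  "orth_compl N = {f. \<forall>g\<in>N. cinner f g = 0}"


section \<open>Model spaces\<close>

definition inner_function :: "complex fps \<Rightarrow> bool" where
  "inner_function \<Theta> \<longleftrightarrow>
     fps_conv_radius \<Theta> \<ge> 1 \<and>
     (\<forall>z\<in>ball 0 1. cmod (eval_fps \<Theta> z) \<le> 1) \<and>
     (AE t in lborel. \<exists>L. cmod L = 1 \<and>
        ((\<lambda>r. eval_fps \<Theta> (complex_of_real r * cis t)) \<longlongrightarrow> L) (at_left 1))"

definition is_model_space :: "hardy set \<Rightarrow> bool" where
  "is_model_space K \<longleftrightarrow>
     (\<exists>\<Theta>. inner_function \<Theta> \<and> K = orth_compl {f. \<exists>g. series f = \<Theta> * series g})"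


section \<open>Functional calculus\<close>

definition resolvent :: "complex mat \<Rightarrow> complex \<Rightarrow> complex mat" where
  "resolvent A z = the (mat_inverse (z \<cdot>\<^sub>m 1\<^sub>m (dim_row A) - A))"

text \<open>
  The Riesz--Dunford integral, entry by entry, for a square matrix of positive dimension with
  spectrum in the unit disc and a function holomorphic there. By Cauchy's theorem the choice of
  the circle around the spectrum inside the disc is immaterial.
\<close>

definition riesz_dunford :: "(complex \<Rightarrow> complex) \<Rightarrow> complex mat \<Rightarrow> complex mat" where
  "riesz_dunford f A = Matrix.mat (dim_row A) (dim_col A) (\<lambda>(i, j).
     1 / (2 * of_real pi * \<i>) *
     contour_integral (circlepath 0 ((1 + spectral_radius A) / 2))
       (\<lambda>z. f z * resolvent A z $$ (i, j)))"

definition matrix_space :: "complex mat \<Rightarrow> hardy set" where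
  "matrix_space A = orth_compl
     {f. riesz_dunford (eval_fps (series f)) A = 0\<^sub>m (dim_row A) (dim_col A)}"


section \<open>Systems of subspaces\<close>

definition vec_angle :: "hardy \<Rightarrow> hardy \<Rightarrow> real" where
  "vec_angle x y = arccos (cmod (cinner x y) / (norm x * norm y))"

definition sin_between :: "hardy set \<Rightarrow> hardy set \<Rightarrow> real" where
  "sin_between K L = Inf {sin (vec_angle x y) | x y. x \<in> K \<and> x \<noteq> 0 \<and> y \<in> L \<and> y \<noteq> 0}"

text \<open>
  The infimum is taken in the extended reals, so that families with at most one member are
  weakly separated.
\<close>

definition weakly_separated :: "'i set \<Rightarrow> ('i \<Rightarrow> hardy set) \<Rightarrow> bool" where
  "weakly_separated I H \<longleftrightarrow>
     0 < (INF (n, j)\<in>{(n, j). n \<in> I \<and> j \<in> I \<and> n \<noteq> j}. ereal (sin_between (H n) (H j)))"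

text \<open>
  The sums converge unconditionally in the norm of \<open>H\<^sup>2\<close>; convergence is part of the definitions.
  Both notions hold vacuously if some member of the family is the zero space, which is excluded
  for \<open>matrix_space A\<close> by taking \<open>A\<close> of positive dimension.
\<close>

definition bessel_system :: "'i set \<Rightarrow> ('i \<Rightarrow> hardy set) \<Rightarrow> bool" where
  "bessel_system I H \<longleftrightarrow> (\<exists>C\<ge>1. \<forall>h a.
     (\<forall>n\<in>I. h n \<in> H n \<and> norm (h n) = 1) \<longrightarrow> (\<lambda>n. (cmod (a n))\<^sup>2) summable_on I \<longrightarrow>
     (\<lambda>n. a n *\<^sub>C h n) summable_on I \<and>
     (norm (\<Sum>\<^sub>\<infinity>n\<in>I. a n *\<^sub>C h n))\<^sup>2 \<le> C\<^sup>2 * (\<Sum>\<^sub>\<infinity>n\<in>I. (cmod (a n))\<^sup>2))"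

definition riesz_system :: "'i set \<Rightarrow> ('i \<Rightarrow> hardy set) \<Rightarrow> bool" where
  "riesz_system I H \<longleftrightarrow> (\<exists>C\<ge>1. \<forall>h a.
     (\<forall>n\<in>I. h n \<in> H n \<and> norm (h n) = 1) \<longrightarrow> (\<lambda>n. (cmod (a n))\<^sup>2) summable_on I \<longrightarrow>
     (\<lambda>n. a n *\<^sub>C h n) summable_on I \<and>
     1 / C\<^sup>2 * (\<Sum>\<^sub>\<infinity>n\<in>I. (cmod (a n))\<^sup>2) \<le> (norm (\<Sum>\<^sub>\<infinity>n\<in>I. a n *\<^sub>C h n))\<^sup>2 \<and>
     (norm (\<Sum>\<^sub>\<infinity>n\<in>I. a n *\<^sub>C h n))\<^sup>2 \<le> C\<^sup>2 * (\<Sum>\<^sub>\<infinity>n\<in>I. (cmod (a n))\<^sup>2))"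

definition finite_disjoint_union ::
  "('i set \<Rightarrow> ('i \<Rightarrow> hardy set) \<Rightarrow> bool) \<Rightarrow> ('i \<Rightarrow> hardy set) \<Rightarrow> bool" where
  "finite_disjoint_union P H \<longleftrightarrow>
     (\<exists>\<I>. finite \<I> \<and> partition_on UNIV \<I> \<and> (\<forall>I\<in>\<I>. P I H))"

end

theory Submission
  imports Defs
begin

text \<open>
  The matrices can be chosen such that the spaces share vectors. If \<open>E n\<close> is a finite set of points of the disc, the
  functions vanishing on \<open>E n\<close> are the multiples of the Blaschke product with zeros \<open>E n\<close>, and their
  orthogonal complement is spanned by the Szego kernels at the points of \<open>E n\<close>
  (\<open>blaschke_product\<close>, \<open>orth_compl_vanishing\<close>). A diagonal matrix with entries \<open>E n\<close> has
  \<open>f(A) = 0\<close> exactly if \<open>f\<close> vanishes on \<open>E n\<close> (\<open>riesz_dunford_mat_diag\<close>), so every such span of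
  kernels is one of the spaces \<open>H\<^sub>n\<close>.

  If all points are taken from a sequence that tends to the circle fast enough, the normalized kernels
  are almost orthonormal (\<open>unit_pt_bounds\<close>): norms of their linear combinations are comparable to
  the \<open>\<ell>\<^sup>2\<close> norm of the coefficients. By the Cauchy--Schwarz inequality the spans then form a Bessel
  system as soon as no point lies in more than a bounded number of the sets \<open>E n\<close>
  (\<open>bessel_system_finite_overlap\<close>). On the other hand, two spans with a common point contain a
  common nonzero vector, so they make an angle zero, and they cannot both belong to a weakly
  separated family or to a Riesz system.

  It remains to find finite sets \<open>E n\<close> in which every point occurs at most twice and such
  that in every finite partition of the indices some cell contains two indices whose sets meet.
  Take the indices as the vertices of a disjoint union of complete graphs of growing finite size, the
  points as the (directed) edges, and let \<open>E n\<close> be the edges at the vertex \<open>n\<close>: an edge has at most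
  two ends, and a partition into \<open>k\<close> cells puts two vertices of a component with
  more than \<open>k\<close> vertices into one cell (\<open>finite_cover_block\<close>).
\<close>

section \<open>The Hardy space as a Hilbert space\<close>

lemma series_simps [simp]:
  "series (f + g) = series f + series g"
  "series (- f) = - series f"
  "series (f - g) = series f - series g"
  "series 0 = 0"
  "series (c *\<^sub>C f) = fps_const c * series f"
proof -
  show "series (f - g) = series f - series g"
    unfolding minus_hardy_def plus_hardy.rep_eq uminus_hardy.rep_eq by (rule add_uminus_conv_diff)
qed (simp_all add: plus_hardy.rep_eq uminus_hardy.rep_eq zero_hardy.rep_eq scaleC.rep_eq)

lemma hardy_eqI: "(\<And>n. fps_nth (series f) n = fps_nth (series g) n) \<Longrightarrow> f = g"
  by (simp add: fps_ext flip: series_inject)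

lemma cinner_cnj: "cinner f g = cnj (cinner g f)"
  using sums_cinner[of g f] sums_cinner[of f g]
  by (auto simp: sums_cnj[of _ "cinner g f", symmetric] intro!: sums_unique2 simp: mult.commute)

lemma cinner_add_left: "cinner (f + g) h = cinner f h + cinner g h"
  by (rule sums_unique2[OF sums_cinner])
    (use sums_add[OF sums_cinner[of f h] sums_cinner[of g h]] in \<open>simp add: algebra_simps\<close>)

lemma cinner_scaleC_left: "cinner (c *\<^sub>C f) g = c * cinner f g"
  by (rule sums_unique2[OF sums_cinner])
    (use sums_mult[OF sums_cinner[of f g], of c] in \<open>simp add: mult.assoc\<close>)

lemma cinner_zero_left [simp]: "cinner 0 g = 0"
  by (simp add: cinner_def)

lemma cinner_diff_left: "cinner (f - g) h = cinner f h - cinner g h"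
  using cinner_add_left[of "f - g" g h] by simp

lemma cinner_sum_left: "cinner (\<Sum>i\<in>F. f i) g = (\<Sum>i\<in>F. cinner (f i) g)"
  by (induction F rule: infinite_finite_induct) (auto simp: cinner_add_left)

lemma cinner_scaleC_right: "cinner f (c *\<^sub>C g) = cnj c * cinner f g"
  by (subst (1 2) cinner_cnj) (simp add: cinner_scaleC_left)

lemma cinner_sum_right: "cinner g (\<Sum>i\<in>F. f i) = (\<Sum>i\<in>F. cinner g (f i))"
  by (subst (1 2) cinner_cnj) (simp add: cinner_sum_left)

lemma norm_hardy_sums: "(\<lambda>n. (cmod (fps_nth (series f) n))\<^sup>2) sums (norm f)\<^sup>2"
  using sums_Re[OF sums_cinner[of f f]]
  by (simp add: inner_hardy_def complex_mult_cnj cmod_power2 power2_norm_eq_inner)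

lemma cinner_self: "cinner f f = of_real ((norm f)\<^sup>2)"
proof (rule sums_unique2[OF sums_cinner])
  show "(\<lambda>n. fps_nth (series f) n * cnj (fps_nth (series f) n)) sums of_real ((norm f)\<^sup>2)"
    unfolding complex_norm_square[symmetric] by (rule sums_of_real[OF norm_hardy_sums])
qed

lemma sum_coeff_le_norm:
  "finite F \<Longrightarrow> (\<Sum>n\<in>F. (cmod (fps_nth (series f) n))\<^sup>2) \<le> (norm f)\<^sup>2"
  using sum_le_suminf[OF summable_series[of f], of F] sums_unique[OF norm_hardy_sums[of f]] by simp

lemma norm_scaleC: "norm (c *\<^sub>C f) = cmod c * norm f"
proof -
  have "complex_of_real ((norm (c *\<^sub>C f))\<^sup>2) = of_real ((cmod c * norm f)\<^sup>2)"
    unfolding cinner_self[symmetric] cinner_scaleC_left cinner_scaleC_right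
    by (simp add: cinner_self power_mult_distrib complex_norm_square[of c] del: of_real_power)
  then show ?thesis
    by (simp only: of_real_eq_iff power2_eq_iff_nonneg norm_ge_zero mult_nonneg_nonneg)
qed

lemma coeff_le_norm: "cmod (fps_nth (series f) n) \<le> norm f"
proof -
  have "(cmod (fps_nth (series f) n))\<^sup>2 \<le> (norm f)\<^sup>2"
    using sum_coeff_le_norm[of "{n}" f] by simp
  then show ?thesis by (simp add: power2_le_iff_abs_le)
qed

lemma scaleC_simps:
  "c *\<^sub>C (f + g) = c *\<^sub>C f + c *\<^sub>C g" "(c + d) *\<^sub>C f = c *\<^sub>C f + d *\<^sub>C f"
  "c *\<^sub>C d *\<^sub>C f = (c * d) *\<^sub>C f" "1 *\<^sub>C f = f" "0 *\<^sub>C f = 0" "c *\<^sub>C 0 = 0"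
  by (rule hardy_eqI; simp add: algebra_simps)+

lemma scaleC_sum_right: "c *\<^sub>C (\<Sum>i\<in>F. f i) = (\<Sum>i\<in>F. c *\<^sub>C f i)"
  by (induction F rule: infinite_finite_induct) (auto simp: scaleC_simps)

lemma scaleC_sum_left: "(\<Sum>i\<in>F. c i) *\<^sub>C f = (\<Sum>i\<in>F. c i *\<^sub>C f)"
  by (induction F rule: infinite_finite_induct) (auto simp: scaleC_simps)

text \<open>
  Completeness is needed because convergence of the sums is part of the definition of a Bessel system.
  As in the classical proof for \<open>\<ell>\<^sup>2\<close>, a Cauchy sequence converges coefficientwise, and the bounds on
  the finite sections of its differences survive in the limit.
\<close>

instance hardy :: banach
proof
  fix X :: "nat \<Rightarrow> hardy"
  assume X: "Cauchy X"
  define c where "c m = lim (\<lambda>k. fps_nth (series (X k)) m)" for m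
  have "Cauchy (\<lambda>k. fps_nth (series (X k)) m)" for m
  proof (rule metric_CauchyI)
    fix e :: real assume "0 < e"
    then obtain M where M: "\<And>i j. i \<ge> M \<Longrightarrow> j \<ge> M \<Longrightarrow> dist (X i) (X j) < e"
      using metric_CauchyD[OF X] by metis
    show "\<exists>M. \<forall>i\<ge>M. \<forall>j\<ge>M. dist (fps_nth (series (X i)) m) (fps_nth (series (X j)) m) < e"
    proof (intro exI allI impI)
      fix i j assume "i \<ge> M" "j \<ge> M"
      then have "norm (X i - X j) < e" using M by (simp add: dist_norm)
      with coeff_le_norm[of "X i - X j" m]
      show "dist (fps_nth (series (X i)) m) (fps_nth (series (X j)) m) < e"
        by (simp add: dist_norm)
    qed
  qed
  then have lim: "(\<lambda>k. fps_nth (series (X k)) m) \<longlonglongrightarrow> c m" for m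
    unfolding c_def by (metis Cauchy_convergent convergent_LIMSEQ_iff)
  have bound: "(\<Sum>m<n. (cmod (fps_nth (series (X i)) m - c m))\<^sup>2) \<le> e\<^sup>2"
    if M: "\<And>i j. i \<ge> M \<Longrightarrow> j \<ge> M \<Longrightarrow> dist (X i) (X j) < e" and "i \<ge> M" for M e i n
  proof (rule tendsto_upperbound)
    show "(\<lambda>j. \<Sum>m<n. (cmod (fps_nth (series (X i)) m - fps_nth (series (X j)) m))\<^sup>2)
            \<longlonglongrightarrow> (\<Sum>m<n. (cmod (fps_nth (series (X i)) m - c m))\<^sup>2)"
      by (intro tendsto_intros lim)
    have "(\<Sum>m<n. (cmod (fps_nth (series (X i)) m - fps_nth (series (X j)) m))\<^sup>2) \<le> e\<^sup>2"
      if "j \<ge> M" for j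
    proof -
      have "(\<Sum>m<n. (cmod (fps_nth (series (X i)) m - fps_nth (series (X j)) m))\<^sup>2)
              \<le> (norm (X i - X j))\<^sup>2"
        using sum_coeff_le_norm[of "{..<n}" "X i - X j"] by simp
      also have "\<dots> \<le> e\<^sup>2"
        using M[OF \<open>i \<ge> M\<close> that] by (intro power_mono) (auto simp: dist_norm)
      finally show ?thesis .
    qed
    then show "\<forall>\<^sub>F j in sequentially.
        (\<Sum>m<n. (cmod (fps_nth (series (X i)) m - fps_nth (series (X j)) m))\<^sup>2) \<le> e\<^sup>2"
      by (auto simp: eventually_sequentially)
  qed simp
  have summable: "summable (\<lambda>m. (cmod (fps_nth (series (X i)) m - c m))\<^sup>2)"
    if "\<And>i j. i \<ge> M \<Longrightarrow> j \<ge> M \<Longrightarrow> dist (X i) (X j) < e" and "i \<ge> M" for M e i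
  proof (rule bounded_imp_summable)
    show "(\<Sum>m\<le>n. (cmod (fps_nth (series (X i)) m - c m))\<^sup>2) \<le> e\<^sup>2" for n
      using bound[OF that, of "Suc n"] unfolding lessThan_Suc_atMost by simp
  qed simp
  obtain M where M: "\<And>i j. i \<ge> M \<Longrightarrow> j \<ge> M \<Longrightarrow> dist (X i) (X j) < 1"
    using metric_CauchyD[OF X, of 1] by auto
  have "summable (\<lambda>m. (cmod (c m))\<^sup>2)"
    using summable_sq_add[OF summable_series[of "X M"]
        summable_sq_mult[OF summable[where i = M, OF M order_refl], where c = "- 1"]] by simp
  then obtain f where f: "series f = Abs_fps c"
    using Hardy_inverse[of "Abs_fps c"] by auto
  have "X \<longlonglongrightarrow> f"
  proof (rule metric_LIMSEQ_I)
    fix e :: real assume "0 < e"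
    then obtain M where M: "\<And>i j. i \<ge> M \<Longrightarrow> j \<ge> M \<Longrightarrow> dist (X i) (X j) < e / 2"
      using metric_CauchyD[OF X, of "e / 2"] half_gt_zero by metis
    have "dist (X i) f < e" if "i \<ge> M" for i
    proof -
      have "(norm (X i - f))\<^sup>2 \<le> (e / 2)\<^sup>2"
      proof (rule LIMSEQ_le_const2)
        show "(\<lambda>n. \<Sum>m<n. (cmod (fps_nth (series (X i - f)) m))\<^sup>2) \<longlonglongrightarrow> (norm (X i - f))\<^sup>2"
          using norm_hardy_sums[of "X i - f"] by (simp add: sums_def)
        show "\<exists>N. \<forall>n\<ge>N. (\<Sum>m<n. (cmod (fps_nth (series (X i - f)) m))\<^sup>2) \<le> (e / 2)\<^sup>2"
          using bound[OF M that] by (simp add: f)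
      qed
      then have "norm (X i - f) \<le> e / 2"
        using \<open>0 < e\<close> by (simp add: power2_le_iff_abs_le)
      with \<open>0 < e\<close> show ?thesis by (simp add: dist_norm)
    qed
    then show "\<exists>no. \<forall>n\<ge>no. dist (X n) f < e" by blast
  qed
  then show "convergent X" by (auto simp: convergent_def)
qed


section \<open>Szego kernels and interpolation\<close>

lemma fps_conv_radius_series: "1 \<le> fps_conv_radius (series f)"
  unfolding fps_conv_radius_def
proof (rule conv_radius_geI_ex')
  fix r :: real assume r: "0 < r" "ereal r < 1"
  show "summable (\<lambda>n. fps_nth (series f) n * of_real r ^ n)"
  proof (rule summable_comparison_test'[where N = 0])
    show "summable (\<lambda>n. norm f * r ^ n)"
      using r by (intro summable_mult summable_geometric) simp
    show "norm (fps_nth (series f) n * of_real r ^ n) \<le> norm f * r ^ n" for n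
      using r coeff_le_norm[of f n] by (simp add: norm_mult norm_power mult_right_mono)
  qed
qed

lemma in_disc_conv_radius: "z \<in> ball 0 1 \<Longrightarrow> ereal (cmod z) < fps_conv_radius (series f)"
  using fps_conv_radius_series[of f] by (simp add: less_le_trans[of _ 1])

lemma holomorphic_series: "eval_fps (series f) holomorphic_on ball 0 1"
  using in_disc_conv_radius[of _ f] by (intro holomorphic_intros) auto

lemma cmod_mult_less_1: "w \<in> ball 0 1 \<Longrightarrow> z \<in> ball 0 1 \<Longrightarrow> cmod (cnj w * z) < 1"
  using mult_strict_mono[of "cmod w" 1 "cmod z" 1] by (simp add: norm_mult)

definition szego :: "complex \<Rightarrow> hardy" where
  "szego w = Hardy (Abs_fps (\<lambda>n. cnj w ^ n))"

lemma series_szego: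
  assumes "w \<in> ball 0 1"
  shows "series (szego w) = Abs_fps (\<lambda>n. cnj w ^ n)"
proof -
  have "summable (\<lambda>n. (cmod (cnj w * w)) ^ n)"
    using cmod_mult_less_1[OF assms assms] by (intro summable_geometric) simp
  then show ?thesis
    unfolding szego_def
    by (intro Hardy_inverse) (simp add: norm_mult norm_power power2_eq_square power_mult_distrib)
qed

lemma cinner_szego:
  assumes "w \<in> ball 0 1"
  shows "cinner f (szego w) = eval_fps (series f) w"
proof (rule sums_unique2)
  show "(\<lambda>n. fps_nth (series f) n * w ^ n) sums cinner f (szego w)"
    using sums_cinner[of f "szego w"] by (simp add: series_szego[OF assms])
qed (rule sums_eval_fps[OF in_disc_conv_radius[OF assms]])

lemma eval_szego:
  assumes "w \<in> ball 0 1" "z \<in> ball 0 1"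
  shows "eval_fps (series (szego w)) z = 1 / (1 - cnj w * z)"
proof -
  have "cmod (cnj w * z) < 1" by (rule cmod_mult_less_1[OF assms])
  then show ?thesis
    using assms by (simp add: eval_fps_def series_szego suminf_geometric flip: power_mult_distrib)
qed

lemma cinner_szego_szego:
  "w \<in> ball 0 1 \<Longrightarrow> z \<in> ball 0 1 \<Longrightarrow> cinner (szego w) (szego z) = 1 / (1 - cnj w * z)"
  by (simp only: cinner_szego eval_szego)

definition vanishing :: "complex set \<Rightarrow> hardy set" where
  "vanishing \<Lambda> = {f. \<forall>w\<in>\<Lambda>. eval_fps (series f) w = 0}"

text \<open>
  Lagrange interpolation: with polynomials \<open>p\<^sub>w\<close> dual to the points of \<open>\<Lambda>\<close>, the difference
  \<open>f - (\<Sum>w\<in>\<Lambda>. f(w) p\<^sub>w)\<close> vanishes on \<open>\<Lambda>\<close> for every \<open>f\<close>. Hence the inner product of \<open>f\<close> with a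
  vector \<open>h\<close> of the complement depends only on the values \<open>f(w)\<close>, which are inner
  products with kernels, and \<open>h\<close> is a combination of these kernels.
\<close>

lemma orth_compl_vanishing:
  assumes fin: "finite \<Lambda>" and sub: "\<Lambda> \<subseteq> ball 0 1"
  shows "orth_compl (vanishing \<Lambda>) = {\<Sum>w\<in>\<Lambda>. c w *\<^sub>C szego w | c. True}"
proof (intro equalityI subsetI)
  fix h assume "h \<in> {\<Sum>w\<in>\<Lambda>. c w *\<^sub>C szego w | c. True}"
  then obtain c where h: "h = (\<Sum>w\<in>\<Lambda>. c w *\<^sub>C szego w)" by auto
  have "cinner (szego w) g = 0" if "g \<in> vanishing \<Lambda>" "w \<in> \<Lambda>" for g w
    using that sub cinner_szego[of w g] by (subst cinner_cnj) (auto simp: vanishing_def)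
  then show "h \<in> orth_compl (vanishing \<Lambda>)"
    by (simp add: h orth_compl_def cinner_sum_left cinner_scaleC_left)
next
  fix h assume h: "h \<in> orth_compl (vanishing \<Lambda>)"
  define q where "q w = (\<Prod>v\<in>\<Lambda> - {w}. Polynomial.smult (1 / (w - v)) [:- v, 1:])" for w
  have q: "poly (q w) v = (if v = w then 1 else 0)" if "w \<in> \<Lambda>" "v \<in> \<Lambda>" for v w
    using that fin by (auto simp: q_def poly_prod diff_divide_distrib[symmetric] intro!: prod.neutral)
  define p where "p w = Hardy (fps_of_poly (q w))" for w
  have p: "series (p w) = fps_of_poly (q w)" for w
    unfolding p_def by (rule Hardy_inverse)
      (auto intro!: summable_finite[of "{..degree (q w)}"] simp: le_degree)
  define s where "s = (\<Sum>w\<in>\<Lambda>. cinner h (p w) *\<^sub>C szego w)"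
  have "cinner h f = cinner s f" for f
  proof -
    define f' where "f' = (\<Sum>w\<in>\<Lambda>. eval_fps (series f) w *\<^sub>C p w)"
    have "eval_fps (series (f - f')) v = 0" if "v \<in> \<Lambda>" for v
    proof -
      have v: "v \<in> ball 0 1" using that sub by auto
      have "eval_fps (series f') v = (\<Sum>w\<in>\<Lambda>. eval_fps (series f) w * eval_fps (series (p w)) v)"
        unfolding f'_def cinner_szego[OF v, symmetric] cinner_sum_left cinner_scaleC_left ..
      also have "\<dots> = (\<Sum>w\<in>\<Lambda>. if v = w then eval_fps (series f) w else 0)"
        using that by (intro sum.cong) (auto simp: p q)
      finally show ?thesis
        using that fin v cinner_diff_left[of f f' "szego v"] by (simp add: cinner_szego del: series_simps)
    qed
    then have "cinner h (f - f') = 0" 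
      using h by (simp add: orth_compl_def vanishing_def del: series_simps)
    then have "cinner h f = cinner h f'"
      by (subst (1 2) cinner_cnj, subst (asm) cinner_cnj) (simp add: cinner_diff_left)
    also have "\<dots> = (\<Sum>w\<in>\<Lambda>. cnj (cinner f (szego w)) * cinner h (p w))"
      unfolding f'_def cinner_sum_right cinner_scaleC_right
      using sub by (intro sum.cong) (auto simp: cinner_szego subset_iff)
    also have "\<dots> = cinner s f"
      unfolding s_def cinner_sum_left cinner_scaleC_left
      by (intro sum.cong) (auto simp: cinner_cnj[of _ f] mult.commute)
    finally show ?thesis .
  qed
  then have "cinner (h - s) (h - s) = 0" by (simp add: cinner_diff_left)
  then have "h = s" by (simp add: cinner_self)
  then show "h \<in> {\<Sum>w\<in>\<Lambda>. c w *\<^sub>C szego w | c. True}" by (auto simp: s_def)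
qed

section \<open>Finite Blaschke products\<close>

text \<open>
  Convexity of the square with weights \<open>1 - s\<close> and \<open>s\<close>. The next two lemmas telescope this
  inequality along a recursion and so replace Young's inequality for the convolution of a
  geometric with a square-summable sequence.
\<close>

lemma square_le_weighted:
  fixes x y z s :: real
  assumes "0 \<le> x" "x \<le> y + s * z" "0 \<le> s" "s < 1"
  shows "x\<^sup>2 \<le> y\<^sup>2 / (1 - s) + s * z\<^sup>2"
proof -
  have "x\<^sup>2 \<le> (y + s * z)\<^sup>2" using assms by (intro power_mono) auto
  also have "\<dots> + s / (1 - s) * (y - (1 - s) * z)\<^sup>2 = y\<^sup>2 / (1 - s) + s * z\<^sup>2"
    using assms by (simp add: field_simps power2_eq_square)
  moreover have "0 \<le> s / (1 - s) * (y - (1 - s) * z)\<^sup>2" using assms by simp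
  ultimately show ?thesis by linarith
qed

text \<open>
  This recursion is satisfied by the coefficients of \<open>g / (1 - w z)\<close> with \<open>\<bar>w\<bar> = s\<close>.
\<close>

lemma summable_sq_forward:
  fixes a v :: "nat \<Rightarrow> complex"
  assumes a: "summable (\<lambda>n. (cmod (a n))\<^sup>2)" and s: "0 \<le> s" "s < 1"
    and v0: "cmod (v 0) \<le> cmod (a 0)"
    and v: "\<And>n. cmod (v (Suc n)) \<le> cmod (a (Suc n)) + s * cmod (v n)"
  shows "summable (\<lambda>n. (cmod (v n))\<^sup>2)"
proof (rule bounded_imp_summable)
  fix n
  have "(1 - s) * (\<Sum>k\<le>n. (cmod (v k))\<^sup>2) + s * (cmod (v n))\<^sup>2
    \<le> (\<Sum>k\<le>n. (cmod (a k))\<^sup>2) / (1 - s)"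
  proof (induction n)
    case 0
    have "(cmod (v 0))\<^sup>2 \<le> (cmod (a 0))\<^sup>2 / (1 - s) + s * 0\<^sup>2"
      using v0 s by (intro square_le_weighted) auto
    then show ?case by (simp add: algebra_simps)
  next
    case (Suc n)
    have "(cmod (v (Suc n)))\<^sup>2 \<le> (cmod (a (Suc n)))\<^sup>2 / (1 - s) + s * (cmod (v n))\<^sup>2"
      using v s by (intro square_le_weighted) auto
    with Suc show ?case by (simp add: algebra_simps add_divide_distrib)
  qed
  also have "\<dots> \<le> (\<Sum>k. (cmod (a k))\<^sup>2) / (1 - s)"
    using s by (intro divide_right_mono sum_le_suminf a) auto
  finally have "(1 - s) * (\<Sum>k\<le>n. (cmod (v k))\<^sup>2) \<le> (\<Sum>k. (cmod (a k))\<^sup>2) / (1 - s)"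
    using mult_nonneg_nonneg[OF s(1) zero_le_power2[of "cmod (v n)"]] by linarith
  then show "(\<Sum>k\<le>n. (cmod (v k))\<^sup>2) \<le> (\<Sum>k. (cmod (a k))\<^sup>2) / (1 - s) / (1 - s)"
    using s by (subst pos_le_divide_eq) (auto simp: mult.commute)
qed simp

text \<open>
  This recursion is satisfied by the coefficients of \<open>f / (z - w)\<close> with \<open>\<bar>w\<bar> = s\<close> and
  \<open>f(w) = 0\<close>. Running backwards, it has no initial value, and the bound \<open>B\<close> takes its place.
\<close>

lemma summable_sq_backward:
  fixes a u :: "nat \<Rightarrow> complex"
  assumes a: "summable (\<lambda>n. (cmod (a n))\<^sup>2)" and s: "0 \<le> s" "s < 1"
    and u: "\<And>n. cmod (u n) \<le> cmod (a n) + s * cmod (u (Suc n))"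
    and B: "\<And>n. cmod (u n) \<le> B"
  shows "summable (\<lambda>n. (cmod (u n))\<^sup>2)"
proof (rule bounded_imp_summable)
  fix n
  have "(1 - s) * (\<Sum>k<n. (cmod (u k))\<^sup>2) \<le> (\<Sum>k<n. (cmod (a k))\<^sup>2) / (1 - s) + s * (cmod (u n))\<^sup>2"
    for n
  proof (induction n)
    case (Suc n)
    have "(cmod (u n))\<^sup>2 \<le> (cmod (a n))\<^sup>2 / (1 - s) + s * (cmod (u (Suc n)))\<^sup>2"
      using u s by (intro square_le_weighted) auto
    with Suc show ?case by (simp add: algebra_simps add_divide_distrib)
  qed (use s in simp)
  from this[of "Suc n"]
  have "(1 - s) * (\<Sum>k\<le>n. (cmod (u k))\<^sup>2)
      \<le> (\<Sum>k\<le>n. (cmod (a k))\<^sup>2) / (1 - s) + s * (cmod (u (Suc n)))\<^sup>2"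
    unfolding lessThan_Suc_atMost .
  also have "\<dots> \<le> (\<Sum>k. (cmod (a k))\<^sup>2) / (1 - s) + s * B\<^sup>2"
    using s B by (intro add_mono divide_right_mono sum_le_suminf a mult_left_mono power_mono) auto
  finally show "(\<Sum>k\<le>n. (cmod (u k))\<^sup>2) \<le> ((\<Sum>k. (cmod (a k))\<^sup>2) / (1 - s) + s * B\<^sup>2) / (1 - s)"
    using s by (subst pos_le_divide_eq) (auto simp: mult.commute)
qed simp

lemma ex_hardyI:
  "summable (\<lambda>n. (cmod (fps_nth F n))\<^sup>2) \<Longrightarrow> \<exists>f. series f = F"
  using Hardy_inverse[of F] by auto

lemma ex_hardy_linear_mult:
  fixes b c :: complex
  shows "\<exists>f. series f = (fps_const b + fps_const c * fps_X) * series g"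
proof (rule ex_hardyI, subst summable_Suc_iff[symmetric])
  have *: "summable (\<lambda>n. (cmod (fps_nth (series g) (Suc n)))\<^sup>2)"
    using summable_series[of g] by (subst summable_Suc_iff)
  show "summable (\<lambda>n. (cmod (fps_nth ((fps_const b + fps_const c * fps_X) * series g) (Suc n)))\<^sup>2)"
    using summable_sq_add[OF summable_sq_mult[OF *, of b] summable_sq_mult[OF summable_series, of c g]]
    by (simp add: algebra_simps)
qed

lemma szego_mult:
  assumes "w \<in> ball 0 1"
  shows "(1 - fps_const (cnj w) * fps_X) * series (szego w) = 1"
proof (rule fps_ext)
  fix n show "fps_nth ((1 - fps_const (cnj w) * fps_X) * series (szego w)) n = fps_nth 1 n"
    using assms by (cases n) (auto simp: series_szego algebra_simps)
qed

lemma ex_hardy_szego_mult: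
  assumes w: "w \<in> ball 0 1"
  shows "\<exists>f. series f = series (szego w) * series g"
proof (rule ex_hardyI, rule summable_sq_forward[OF summable_series[of g], of "cmod w"])
  define F where "F = series (szego w) * series g"
  have "(1 - fps_const (cnj w) * fps_X) * F = series g"
    using szego_mult[OF w] by (simp add: F_def mult.assoc[symmetric])
  then have g: "fps_nth (series g) n = fps_nth ((1 - fps_const (cnj w) * fps_X) * F) n" for n
    by simp
  have "fps_nth F (Suc n) = fps_nth (series g) (Suc n) + cnj w * fps_nth F n" for n
    using g[of "Suc n"] by (simp add: left_diff_distrib mult.assoc)
  then show "cmod (fps_nth (series (szego w) * series g) (Suc n))
      \<le> cmod (fps_nth (series g) (Suc n)) + cmod w * cmod (fps_nth (series (szego w) * series g) n)" for n
    unfolding F_def[symmetric] by (metis norm_triangle_ineq norm_mult complex_mod_cnj)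
  show "cmod (fps_nth (series (szego w) * series g) 0) \<le> cmod (fps_nth (series g) 0)"
    using g[of 0] unfolding F_def[symmetric] by (simp add: left_diff_distrib mult.assoc)
qed (use w in auto)

definition blaschke :: "complex \<Rightarrow> complex fps" where
  "blaschke w = (fps_X - fps_const w) * series (szego w)"

lemma ex_hardy_blaschke_mult:
  assumes "w \<in> ball 0 1"
  shows "\<exists>f. series f = blaschke w * series g"
proof -
  obtain g' where g': "series g' = series (szego w) * series g"
    using ex_hardy_szego_mult[OF assms] by blast
  obtain f where "series f = (fps_const (- w) + fps_const 1 * fps_X) * series g'"
    using ex_hardy_linear_mult by blast
  also have "\<dots> = blaschke w * series g"
    by (simp add: g' blaschke_def algebra_simps flip: fps_const_neg)
  finally show ?thesis by blast
qed

text \<open>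
  The shifted tails \<open>r n = (\<Sum>k. f\<^bsub>n + k\<^esub> w ^ k)\<close> are the coefficients of
  \<open>z f / (z - w)\<close>, since the hypothesis \<open>f(w) = 0\<close> says \<open>r 0 = 0\<close>. So \<open>u = f / (z - w)\<close> lies in
  the Hardy space, and the quotient by the Blaschke factor is \<open>(1 - cnj w z) u\<close>.
\<close>

lemma blaschke_divides:
  assumes w: "w \<in> ball 0 1" and zero: "eval_fps (series f) w = 0"
  shows "\<exists>g. series f = blaschke w * series g"
proof -
  define a where "a = fps_nth (series f)"
  have bound: "norm (a (n + k) * w ^ k) \<le> norm f * cmod w ^ k" for n k
    using coeff_le_norm[of f "n + k"] by (simp add: norm_mult norm_power a_def mult_right_mono)
  have sums: "(\<lambda>k. norm f * cmod w ^ k) sums (norm f * (1 / (1 - cmod w)))"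
    using w by (intro sums_mult geometric_sums) auto
  have summable: "summable (\<lambda>k. a (n + k) * w ^ k)" for n
    by (rule summable_comparison_test'[OF sums_summable[OF sums]]) (rule bound)
  define r where "r n = (\<Sum>k. a (n + k) * w ^ k)" for n
  have r_Suc: "r n = a n + w * r (Suc n)" for n
  proof -
    have "r n = (\<Sum>k. a (n + Suc k) * w ^ Suc k) + a n"
      unfolding r_def by (subst suminf_split_head[OF summable]) simp
    also have "(\<Sum>k. a (n + Suc k) * w ^ Suc k) = w * r (Suc n)"
      unfolding r_def by (subst suminf_mult[OF summable, symmetric]) (simp add: algebra_simps)
    finally show ?thesis by (simp add: add.commute)
  qed
  have r_bound: "cmod (r n) \<le> norm f * (1 / (1 - cmod w))" for n
    unfolding r_def sums_unique[OF sums] by (rule norm_suminf_le[OF bound sums_summable[OF sums]])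
  have r0: "r 0 = 0"
    using zero by (simp add: r_def a_def eval_fps_def)
  have "summable (\<lambda>n. (cmod (r n))\<^sup>2)"
  proof (rule summable_sq_backward[OF summable_series[of f]])
    show "cmod (r n) \<le> cmod (fps_nth (series f) n) + cmod w * cmod (r (Suc n))" for n
      unfolding a_def[symmetric] by (metis r_Suc norm_triangle_ineq norm_mult)
  qed (use w r_bound in auto)
  then have "summable (\<lambda>n. (cmod (r (Suc n)))\<^sup>2)" by (subst summable_Suc_iff)
  then obtain u where u: "series u = Abs_fps (\<lambda>n. r (Suc n))"
    using ex_hardyI[of "Abs_fps (\<lambda>n. r (Suc n))"] by auto
  have f: "series f = (fps_X - fps_const w) * series u"
  proof (rule fps_ext)
    fix n show "fps_nth (series f) n = fps_nth ((fps_X - fps_const w) * series u) n"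
      using r0 r_Suc[of n] by (cases n) (auto simp: u algebra_simps a_def eq_neg_iff_add_eq_0)
  qed
  obtain g where "series g = (fps_const 1 + fps_const (- cnj w) * fps_X) * series u"
    using ex_hardy_linear_mult by blast
  then have g: "series g = (1 - fps_const (cnj w) * fps_X) * series u"
    by (simp flip: fps_const_neg)
  have "blaschke w * series g
      = (fps_X - fps_const w) * ((1 - fps_const (cnj w) * fps_X) * series (szego w)) * series u"
    by (simp only: g blaschke_def mult_ac)
  then show ?thesis using szego_mult[OF w] f by (intro exI[of _ g]) simp
qed

text \<open>
  This gives both modulus at most 1 in the disc and modulus 1 on the circle for Blaschke factors.
\<close>

lemma moebius_identity:
  "(cmod (1 - cnj w * z))\<^sup>2 - (cmod (z - w))\<^sup>2 = (1 - (cmod z)\<^sup>2) * (1 - (cmod w)\<^sup>2)"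
  unfolding cmod_power2 by (simp add: power2_eq_square algebra_simps)

lemma fps_conv_radius_blaschke: "1 \<le> fps_conv_radius (blaschke w)"
proof -
  have "fps_conv_radius (fps_X - fps_const w) = \<infinity>"
    using fps_conv_radius_diff[of fps_X "fps_const w"] by simp
  then show ?thesis
    using fps_conv_radius_mult[of "fps_X - fps_const w" "series (szego w)"]
      fps_conv_radius_series[of "szego w"]
    by (simp add: blaschke_def)
qed

lemma eval_blaschke:
  assumes "w \<in> ball 0 1" "z \<in> ball 0 1"
  shows "eval_fps (blaschke w) z = (z - w) / (1 - cnj w * z)"
proof -
  have inf: "fps_conv_radius (fps_X - fps_const w) = \<infinity>"
    using fps_conv_radius_diff[of fps_X "fps_const w"] by simp
  show ?thesis
    using assms in_disc_conv_radius[OF assms(2)]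
    by (simp add: blaschke_def eval_fps_mult eval_fps_diff inf eval_szego)
qed

text \<open>
  Induction on the zeros, splitting off one Blaschke factor by \<open>blaschke_divides\<close>; the remaining
  quotient still vanishes at the other zeros because a Blaschke factor has only one zero. Conversely, a
  multiple of the product is read once as a multiple of the new factor and once as a multiple of
  the old product. Both readings require that products with Blaschke factors stay in the Hardy space.
\<close>

lemma blaschke_product:
  assumes "finite \<Lambda>" "\<Lambda> \<subseteq> ball 0 1"
  defines "\<Theta> \<equiv> \<Prod>w\<in>\<Lambda>. blaschke w"
  shows "1 \<le> fps_conv_radius \<Theta>"
    and "z \<in> ball 0 1 \<Longrightarrow> eval_fps \<Theta> z = (\<Prod>w\<in>\<Lambda>. (z - w) / (1 - cnj w * z))"
    and "vanishing \<Lambda> = {f. \<exists>g. series f = \<Theta> * series g}"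
proof -
  have "1 \<le> fps_conv_radius \<Theta> \<and>
    (\<forall>z\<in>ball 0 1. eval_fps \<Theta> z = (\<Prod>w\<in>\<Lambda>. (z - w) / (1 - cnj w * z))) \<and>
    (\<forall>g. \<exists>f. series f = \<Theta> * series g) \<and>
    vanishing \<Lambda> = {f. \<exists>g. series f = \<Theta> * series g}"
    using assms(1,2) unfolding \<Theta>_def
  proof (induction \<Lambda> rule: finite_induct)
    case empty
    then show ?case by (auto simp: vanishing_def)
  next
    case (insert w \<Lambda>)
    let ?\<Theta> = "\<Prod>w\<in>\<Lambda>. blaschke w"
    have w: "w \<in> ball 0 1" and \<Lambda>: "\<Lambda> \<subseteq> ball 0 1" using insert.prems by auto
    note IH = insert.IH[OF \<Lambda>]
    have prod: "(\<Prod>w\<in>insert w \<Lambda>. blaschke w) = blaschke w * ?\<Theta>"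
      using insert.hyps by simp
    have rad: "1 \<le> fps_conv_radius (blaschke w * ?\<Theta>)"
      using fps_conv_radius_mult[of "blaschke w" ?\<Theta>] IH fps_conv_radius_blaschke[of w]
      by (meson min.boundedI order_trans)
    have eval: "eval_fps (blaschke w * F) z = (z - w) / (1 - cnj w * z) * eval_fps F z"
      if "z \<in> ball 0 1" "1 \<le> fps_conv_radius F" for z F
    proof -
      have "ereal (cmod z) < 1" using that by simp
      then have "eval_fps (blaschke w * F) z = eval_fps (blaschke w) z * eval_fps F z"
        using that(2) fps_conv_radius_blaschke[of w]
        by (intro eval_fps_mult) (blast intro: less_le_trans)+
      then show ?thesis using w that by (simp add: eval_blaschke)
    qed
    have closed: "\<exists>f. series f = blaschke w * ?\<Theta> * series g" for g
      using IH ex_hardy_blaschke_mult[OF w] by (metis mult.assoc)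
    have "vanishing (insert w \<Lambda>) = {f. \<exists>g. series f = blaschke w * ?\<Theta> * series g}"
    proof (intro equalityI subsetI)
      fix f assume f: "f \<in> vanishing (insert w \<Lambda>)"
      then obtain g where g: "series f = blaschke w * series g"
        using blaschke_divides[OF w, of f] by (auto simp: vanishing_def)
      have "eval_fps (series g) v = 0" if "v \<in> \<Lambda>" for v
      proof -
        have v: "v \<in> ball 0 1" "v \<noteq> w" using that \<Lambda> insert.hyps by auto
        have "cmod (cnj w * v) < 1" by (rule cmod_mult_less_1[OF w v(1)])
        then have "1 - cnj w * v \<noteq> 0" by force
        moreover have "eval_fps (series f) v = 0" using f that by (simp add: vanishing_def)
        ultimately show ?thesis
          using eval[OF v(1) fps_conv_radius_series, of g] v g by simp
      qed
      then have "g \<in> vanishing \<Lambda>" by (simp add: vanishing_def)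
      then show "f \<in> {f. \<exists>g. series f = blaschke w * ?\<Theta> * series g}"
        using IH g by (auto simp: mult.assoc)
    next
      fix f assume "f \<in> {f. \<exists>g. series f = blaschke w * ?\<Theta> * series g}"
      then obtain g where g: "series f = blaschke w * ?\<Theta> * series g" by blast
      obtain h where h: "series h = blaschke w * series g" 
        using ex_hardy_blaschke_mult[OF w] by blast
      have "series f = ?\<Theta> * series h" using g h by (simp add: mult_ac)
      then have "f \<in> vanishing \<Lambda>" using IH by blast
      obtain k where "series k = ?\<Theta> * series g" using IH by blast
      then have "series f = blaschke w * series k" using g by (simp add: mult.assoc)
      then have "eval_fps (series f) w = 0"
        using eval[OF w fps_conv_radius_series, of k] by simp
      with \<open>f \<in> vanishing \<Lambda>\<close> show "f \<in> vanishing (insert w \<Lambda>)"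
        by (simp add: vanishing_def)
    qed
    then show ?case
      unfolding prod using rad closed IH eval insert.hyps by simp
  qed
  then show "1 \<le> fps_conv_radius \<Theta>"
    and "z \<in> ball 0 1 \<Longrightarrow> eval_fps \<Theta> z = (\<Prod>w\<in>\<Lambda>. (z - w) / (1 - cnj w * z))"
    and "vanishing \<Lambda> = {f. \<exists>g. series f = \<Theta> * series g}"
    by blast+
qed

lemma is_model_space_vanishing:
  assumes fin: "finite \<Lambda>" and sub: "\<Lambda> \<subseteq> ball 0 1"
  shows "is_model_space (orth_compl (vanishing \<Lambda>))"
proof -
  define \<Theta> where "\<Theta> = (\<Prod>w\<in>\<Lambda>. blaschke w)"
  note \<Theta> = blaschke_product[OF fin sub, folded \<Theta>_def]
  have nz: "1 - cnj w * z \<noteq> 0" if "w \<in> \<Lambda>" "cmod z \<le> 1" for w z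
  proof -
    have "cmod w < 1" using that sub by auto
    moreover have "cmod w * cmod z \<le> cmod w * 1" using that by (intro mult_left_mono) auto
    ultimately have "cmod (cnj w * z) < 1" by (simp add: norm_mult)
    then show ?thesis by force
  qed
  have le: "cmod (eval_fps \<Theta> z) \<le> 1" if z: "z \<in> ball 0 1" for z
  proof -
    have "cmod ((z - w) / (1 - cnj w * z)) \<le> 1" if "w \<in> \<Lambda>" for w
    proof -
      have "0 \<le> (1 - (cmod z)\<^sup>2) * (1 - (cmod w)\<^sup>2)"
      proof (rule mult_nonneg_nonneg)
        have "cmod w < 1" "cmod z < 1" using z that sub by auto
        then show "0 \<le> 1 - (cmod z)\<^sup>2" "0 \<le> 1 - (cmod w)\<^sup>2"
          by (simp_all add: power_le_one)
      qed
      then have "cmod (z - w) \<le> cmod (1 - cnj w * z)"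
        using moebius_identity[of w z] by (intro power2_le_imp_le[OF _ norm_ge_zero]) linarith
      then show ?thesis using nz[OF that, of z] z by (simp add: norm_divide)
    qed
    then show ?thesis
      using z by (simp only: \<Theta>(2) prod_norm[symmetric]) (intro prod_le_1, auto)
  qed
  have lim: "\<exists>L. cmod L = 1 \<and>
      ((\<lambda>r. eval_fps \<Theta> (complex_of_real r * cis t)) \<longlongrightarrow> L) (at_left 1)" for t
  proof (intro exI conjI)
    let ?P = "\<lambda>z. \<Prod>w\<in>\<Lambda>. (z - w) / (1 - cnj w * z)"
    have "cmod ((cis t - w) / (1 - cnj w * cis t)) = 1" if "w \<in> \<Lambda>" for w
    proof -
      have "cmod (cis t - w) = cmod (1 - cnj w * cis t)"
        using moebius_identity[of w "cis t"] by (simp add: power2_eq_iff_nonneg)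
      then show ?thesis using nz[OF that, of "cis t"] by (simp add: norm_divide)
    qed
    then show "cmod (?P (cis t)) = 1"
      by (simp add: prod_norm[symmetric])
    have "((\<lambda>r. ?P (complex_of_real r * cis t)) \<longlongrightarrow> ?P (complex_of_real 1 * cis t)) (at_left 1)"
      using nz[of _ "cis t"] by (intro tendsto_intros) auto
    moreover have "\<forall>\<^sub>F r in at_left 1. ?P (complex_of_real r * cis t)
        = eval_fps \<Theta> (complex_of_real r * cis t)"
    proof -
      have "\<forall>\<^sub>F r::real in at_left 1. 0 < r \<and> r < 1"
        using eventually_at_left_real[of 0 1] by (auto elim: eventually_mono)
      then show ?thesis by eventually_elim (simp add: \<Theta>(2) norm_mult)
    qed
    ultimately show "((\<lambda>r. eval_fps \<Theta> (complex_of_real r * cis t)) \<longlongrightarrow> ?P (cis t)) (at_left 1)"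
      by (simp add: tendsto_cong)
  qed
  have "inner_function \<Theta>"
    unfolding inner_function_def using \<Theta>(1) le lim by auto
  then show ?thesis
    unfolding is_model_space_def using \<Theta>(3) by auto
qed

section \<open>Diagonal matrices\<close>

lemma spectrum_mat_diag: "spectrum (mat_diag k \<mu>) = \<mu> ` {..<k}"
  for \<mu> :: "nat \<Rightarrow> complex"
proof -
  have "upper_triangular (mat_diag k \<mu>)"
    by (auto simp: mat_diag_def upper_triangular_def)
  then have "char_poly (mat_diag k \<mu>) = (\<Prod>a\<leftarrow>diag_mat (mat_diag k \<mu>). [:- a, 1:])"
    by (rule char_poly_upper_triangular[OF mat_diag_dim])
  moreover have "diag_mat (mat_diag k \<mu>) = map \<mu> [0..<k]"
    by (auto simp: diag_mat_def mat_diag_def)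
  ultimately show ?thesis
    by (auto simp: spectrum_root_char_poly[OF mat_diag_dim] poly_prod_list prod_list_zero_iff o_def)
qed

text \<open>
  The resolvent is defined by an algorithm for inverting matrices; its result is identified by the
  uniqueness of inverses.
\<close>

lemma resolvent_mat_diag:
  assumes "\<And>i. i < k \<Longrightarrow> z \<noteq> \<mu> i"
  shows "resolvent (mat_diag k \<mu>) z = mat_diag k (\<lambda>i. 1 / (z - \<mu> i))"
proof -
  define M where "M = z \<cdot>\<^sub>m 1\<^sub>m k - mat_diag k \<mu>"
  define R where "R = mat_diag k (\<lambda>i. 1 / (z - \<mu> i))"
  have M: "M = mat_diag k (\<lambda>i. z - \<mu> i)"
    by (rule eq_matI) (auto simp: M_def mat_diag_def)
  have one: "mat_diag k f = 1\<^sub>m k" if "\<And>i. i < k \<Longrightarrow> f i = (1 :: complex)" for f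
    using that by (intro eq_matI) (auto simp: mat_diag_def)
  have MR: "M * R = 1\<^sub>m k" "R * M = 1\<^sub>m k"
    using assms by (auto simp: M R_def intro!: one)
  have carrier: "M \<in> carrier_mat k k" "R \<in> carrier_mat k k"
    by (simp_all add: M R_def)
  have "M \<in> Units (ring_mat TYPE(complex) k ())"
    using MR carrier by (auto simp: Units_def ring_mat_def)
  then obtain B where B: "mat_inverse M = Some B"
    using mat_inverse(1)[OF carrier(1), where b = "()"] by (cases "mat_inverse M") auto
  then have "B * M = 1\<^sub>m k" "B \<in> carrier_mat k k"
    using mat_inverse(2)[OF carrier(1)] by auto
  then have "B = R"
    using MR carrier assoc_mult_mat[of B k k M k R k] by simp
  then show ?thesis
    using B by (simp add: resolvent_def M_def R_def mat_diag_def)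
qed

lemma riesz_dunford_mat_diag:
  assumes "0 < k" and \<mu>: "\<And>i. i < k \<Longrightarrow> \<mu> i \<in> ball 0 1"
    and f: "f holomorphic_on ball 0 1"
  shows "riesz_dunford f (mat_diag k \<mu>) = mat_diag k (\<lambda>i. f (\<mu> i))"
proof (rule eq_matI)
  define \<rho> where "\<rho> = spectral_radius (mat_diag k \<mu>)"
  define r where "r = (1 + \<rho>) / 2"
  note rad = spectral_radius_mem_max[where A = "mat_diag k \<mu>", OF mat_diag_dim \<open>0 < k\<close>, folded \<rho>_def,
      unfolded spectrum_mat_diag]
  have \<rho>: "\<rho> < 1" "0 \<le> \<rho>" using rad(1) \<mu> by auto
  then have r: "0 < r" "r < 1" "\<rho> < r" by (auto simp: r_def)
  have in_disc: "cmod (\<mu> i) < r" if "i < k" for i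
    using rad(2)[of "cmod (\<mu> i)"] that r by auto
  fix i j
  assume "i < dim_row (mat_diag k (\<lambda>i. f (\<mu> i)))" "j < dim_col (mat_diag k (\<lambda>i. f (\<mu> i)))"
  then have ij: "i < k" "j < k" by (simp_all add: mat_diag_def)
  have "contour_integral (circlepath 0 r) (\<lambda>z. f z * resolvent (mat_diag k \<mu>) z $$ (i, j))
      = contour_integral (circlepath 0 r) (\<lambda>z. if i = j then f z / (z - \<mu> i) else 0)"
  proof (rule contour_integral_eq)
    fix z assume "z \<in> path_image (circlepath 0 r)"
    then have "z \<noteq> \<mu> l" if "l < k" for l using in_disc[OF that] r by auto
    then show "f z * resolvent (mat_diag k \<mu>) z $$ (i, j) = (if i = j then f z / (z - \<mu> i) else 0)"
      using ij by (subst resolvent_mat_diag) (auto simp: mat_diag_def)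
  qed
  also have "\<dots> = (if i = j then 2 * of_real pi * \<i> * f (\<mu> i) else 0)"
  proof (cases "i = j")
    case True
    have "f holomorphic_on cball 0 r" using r by (intro holomorphic_on_subset[OF f]) auto
    then show ?thesis
      using True in_disc[OF ij(1)] contour_integral_unique[OF Cauchy_integral_circlepath_simple]
      by simp
  qed simp
  finally show "riesz_dunford f (mat_diag k \<mu>) $$ (i, j) = mat_diag k (\<lambda>i. f (\<mu> i)) $$ (i, j)"
    using ij by (simp add: riesz_dunford_def mat_diag_def[of k "\<lambda>i. f (\<mu> i)"] r_def \<rho>_def
        carrier_matD[OF mat_diag_dim])
qed (simp_all add: riesz_dunford_def mat_diag_def)

lemma ex_matrix_space:
  assumes "finite \<Lambda>" "\<Lambda> \<noteq> {}" "\<Lambda> \<subseteq> ball 0 1"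
  shows "\<exists>A. square_mat A \<and> 0 < dim_row A \<and> spectrum A = \<Lambda>
    \<and> matrix_space A = orth_compl (vanishing \<Lambda>)"
proof -
  obtain k and \<mu> :: "nat \<Rightarrow> complex" where \<mu>: "\<Lambda> = \<mu> ` {i. i < k}"
    using finite_imp_nat_seg_image_inj_on[OF assms(1)] by blast
  have k: "0 < k" using \<mu> assms(2) by (cases k) auto
  have ball: "\<mu> i \<in> ball 0 1" if "i < k" for i using that \<mu> assms(3) by auto
  have "riesz_dunford (eval_fps (series f)) (mat_diag k \<mu>)
      = 0\<^sub>m (dim_row (mat_diag k \<mu>)) (dim_col (mat_diag k \<mu>)) \<longleftrightarrow> f \<in> vanishing \<Lambda>" for f
  proof -
    have "mat_diag k (\<lambda>i. eval_fps (series f) (\<mu> i)) = 0\<^sub>m k k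
        \<longleftrightarrow> (\<forall>i<k. eval_fps (series f) (\<mu> i) = 0)"
      by (auto simp: mat_eq_iff mat_diag_def)
    then show ?thesis
      using k ball carrier_matD[OF mat_diag_dim[of k \<mu>]]
      by (simp add: riesz_dunford_mat_diag holomorphic_series vanishing_def \<mu>)
  qed
  then have "matrix_space (mat_diag k \<mu>) = orth_compl (vanishing \<Lambda>)"
    by (simp add: matrix_space_def)
  moreover have "spectrum (mat_diag k \<mu>) = \<Lambda>"
    by (auto simp: spectrum_mat_diag \<mu>)
  ultimately show ?thesis
    using k by (intro exI[of _ "mat_diag k \<mu>"]) (simp add: mat_diag_def)
qed

section \<open>Almost orthonormal kernels\<close>

text \<open>
  The off-diagonal part of the Gram matrix is dominated by the rank one matrix \<open>\<delta>\<^sub>i \<delta>\<^sub>j\<close>, whose norm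
  is \<open>\<Sum> \<delta>\<^sub>i\<^sup>2 \<le> 1 / 2\<close>.
\<close>

lemma almost_orthonormal:
  assumes "finite F" and norm: "\<And>i. i \<in> F \<Longrightarrow> norm (e i) = 1"
    and off: "\<And>i j. i \<in> F \<Longrightarrow> j \<in> F \<Longrightarrow> i \<noteq> j \<Longrightarrow> cmod (cinner (e i) (e j)) \<le> \<delta> i * \<delta> j"
    and \<delta>: "(\<Sum>i\<in>F. (\<delta> i)\<^sup>2) \<le> 1 / 2"
  shows "\<bar>(norm (\<Sum>i\<in>F. b i *\<^sub>C e i))\<^sup>2 - (\<Sum>i\<in>F. (cmod (b i))\<^sup>2)\<bar> \<le> (\<Sum>i\<in>F. (cmod (b i))\<^sup>2) / 2"
proof -
  let ?S = "\<Sum>i\<in>F. b i *\<^sub>C e i"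
  let ?off = "\<lambda>i j. if i = j then 0 else b i * cnj (b j) * cinner (e i) (e j)"
  have "complex_of_real ((norm ?S)\<^sup>2) = (\<Sum>i\<in>F. \<Sum>j\<in>F. b i * cnj (b j) * cinner (e i) (e j))"
    unfolding cinner_self[symmetric] cinner_sum_left cinner_sum_right cinner_scaleC_left cinner_scaleC_right
    by (simp add: sum_distrib_left mult_ac) (rule sum.swap)
  also have "\<dots> = (\<Sum>i\<in>F. \<Sum>j\<in>F. ?off i j + (if i = j then of_real ((cmod (b i))\<^sup>2) else 0))"
    using norm by (intro sum.cong) (auto simp: cinner_self complex_norm_square simp del: of_real_power)
  also have "\<dots> = (\<Sum>i\<in>F. \<Sum>j\<in>F. ?off i j) + of_real (\<Sum>i\<in>F. (cmod (b i))\<^sup>2)"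
    using \<open>finite F\<close> by (simp add: sum.distrib)
  finally have "complex_of_real ((norm ?S)\<^sup>2 - (\<Sum>i\<in>F. (cmod (b i))\<^sup>2)) = (\<Sum>i\<in>F. \<Sum>j\<in>F. ?off i j)"
    by simp
  from arg_cong[OF this, of cmod]
  have "\<bar>(norm ?S)\<^sup>2 - (\<Sum>i\<in>F. (cmod (b i))\<^sup>2)\<bar> = cmod (\<Sum>i\<in>F. \<Sum>j\<in>F. ?off i j)"
    unfolding norm_of_real .
  also have "\<dots> \<le> (\<Sum>i\<in>F. \<Sum>j\<in>F. (cmod (b i) * \<delta> i) * (cmod (b j) * \<delta> j))"
  proof (intro sum_norm_le order_trans[OF norm_sum] sum_mono)
    fix i j assume ij: "i \<in> F" "j \<in> F"
    show "cmod (?off i j) \<le> (cmod (b i) * \<delta> i) * (cmod (b j) * \<delta> j)"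
    proof (cases "i = j")
      case False
      have "cmod (b i) * cmod (b j) * cmod (cinner (e i) (e j)) \<le> cmod (b i) * cmod (b j) * (\<delta> i * \<delta> j)"
        using off[OF ij False] by (intro mult_left_mono) auto
      then show ?thesis using False by (simp add: norm_mult mult_ac)
    qed simp
  qed
  also have "\<dots> = (\<Sum>i\<in>F. cmod (b i) * \<delta> i)\<^sup>2"
    by (simp add: sum_product power2_eq_square)
  also have "\<dots> \<le> (\<Sum>i\<in>F. (cmod (b i))\<^sup>2) * (\<Sum>i\<in>F. (\<delta> i)\<^sup>2)"
    by (rule Cauchy_Schwarz_ineq_sum)
  also have "\<dots> \<le> (\<Sum>i\<in>F. (cmod (b i))\<^sup>2) * (1 / 2)"
    by (intro mult_left_mono \<delta> sum_nonneg) auto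
  finally show ?thesis by simp
qed

text \<open>
  With \<open>t\<^sub>i = 2 powr -(i + 2)\<^sup>2\<close> the points are \<open>1 - t\<^sub>i\<^sup>2\<close>. Two normalized kernels have an inner
  product of at most \<open>4 t\<^sub>j / t\<^sub>i\<close> for \<open>i < j\<close>. The exponent is quadratic because this
  quotient has to be bounded by a product \<open>\<delta>\<^sub>i \<delta>\<^sub>j\<close>, here with \<open>\<delta>\<^sub>i = 2 powr -(i + 1)\<close>, not just by
  a function of \<open>j - i\<close>; the shift by 2 absorbs the factor 4.
\<close>

definition pt :: "nat \<Rightarrow> complex" where
  "pt i = of_real (1 - ((1 / 2) ^ (i + 2)\<^sup>2)\<^sup>2)"

definition unit_szego :: "complex \<Rightarrow> hardy" where
  "unit_szego w = complex_of_real (sqrt (1 - (cmod w)\<^sup>2)) *\<^sub>C szego w"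

lemma norm_unit_szego:
  assumes "w \<in> ball 0 1"
  shows "norm (unit_szego w) = 1"
proof -
  have w: "0 < 1 - (cmod w)\<^sup>2" using assms by (simp add: abs_square_less_1)
  have "complex_of_real ((norm (szego w))\<^sup>2) = of_real (1 / (1 - (cmod w)\<^sup>2))"
    unfolding cinner_self[symmetric] cinner_szego_szego[OF assms assms]
    by (simp add: complex_norm_square mult.commute del: of_real_power)
  then have "(norm (szego w))\<^sup>2 = 1 / (1 - (cmod w)\<^sup>2)"
    by (simp only: of_real_eq_iff)
  then have "(norm (unit_szego w))\<^sup>2 = 1"
    using w by (simp add: unit_szego_def norm_scaleC power_mult_distrib)
  then show ?thesis using power2_eq_iff_nonneg[of "norm (unit_szego w)" 1] by simp
qed

lemma pt_in_ball: "pt i \<in> ball 0 1"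
proof -
  have "0 < ((1 / 2 :: real) ^ (i + 2)\<^sup>2)\<^sup>2" "((1 / 2 :: real) ^ (i + 2)\<^sup>2)\<^sup>2 \<le> 1"
    by (simp_all add: power_le_one)
  then show ?thesis by (simp only: pt_def mem_ball_0 norm_of_real)
qed

lemma pt_decay:
  assumes "i < j"
  shows "(1 / 2 :: real) ^ (j + 2)\<^sup>2 \<le> (1 / 2) ^ (i + 2)\<^sup>2 * (1 / 2) ^ (i + j + 4)"
proof -
  obtain d where "j = Suc (i + d)" using assms less_imp_Suc_add by blast
  then have "(i + 2)\<^sup>2 + (i + j + 4) \<le> (j + 2)\<^sup>2"
    by (simp add: power2_eq_square algebra_simps)
  then have "(1 / 2 :: real) ^ (j + 2)\<^sup>2 \<le> (1 / 2) ^ ((i + 2)\<^sup>2 + (i + j + 4))"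
    by (intro power_decreasing) auto
  then show ?thesis by (simp add: power_add)
qed

lemma cinner_unit_pt_less:
  assumes "i < j"
  shows "cmod (cinner (unit_szego (pt i)) (unit_szego (pt j))) \<le> (1 / 2) ^ (i + 1) * (1 / 2) ^ (j + 1)"
proof -
  define t where "t i = (1 / 2 :: real) ^ (i + 2)\<^sup>2" for i :: nat
  have t: "0 < t i" "t i \<le> 1" for i by (simp_all add: t_def power_le_one)
  have t2: "0 < (t i)\<^sup>2" "(t i)\<^sup>2 \<le> 1" for i using t[of i] by (simp_all add: power_le_one)
  have pt: "pt i = of_real (1 - (t i)\<^sup>2)" for i by (simp add: pt_def t_def)
  have sq: "sqrt (1 - (cmod (pt i))\<^sup>2) \<le> 2 * t i" for i
  proof (rule real_le_lsqrt)
    have "1 - (1 - (t i)\<^sup>2)\<^sup>2 = 2 * (t i)\<^sup>2 - ((t i)\<^sup>2)\<^sup>2"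
      by (simp add: power2_eq_square algebra_simps)
    also have "\<dots> \<le> 4 * (t i)\<^sup>2" using t2[of i] zero_le_power2[of "(t i)\<^sup>2"] by linarith
    also have "\<dots> = (2 * t i)\<^sup>2" by (simp add: power_mult_distrib)
    finally show "1 - (cmod (pt i))\<^sup>2 \<le> (2 * t i)\<^sup>2"
      by (simp only: pt norm_of_real power2_abs)
  qed (use t[of i] in auto)
  have nn: "0 \<le> sqrt (1 - (cmod (pt i))\<^sup>2)" for i
    using pt_in_ball[of i] by (simp add: abs_square_le_1)
  have denom: "(t i)\<^sup>2 \<le> 1 - (1 - (t i)\<^sup>2) * (1 - (t j)\<^sup>2)"
    using mult_left_mono[of "1 - (t j)\<^sup>2" 1 "1 - (t i)\<^sup>2"] t2[of i] t2[of j] by simp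
  then have denom_pos: "0 < 1 - (1 - (t i)\<^sup>2) * (1 - (t j)\<^sup>2)"
    using t2(1)[of i] by linarith
  have "cmod (cinner (unit_szego (pt i)) (unit_szego (pt j)))
      = sqrt (1 - (cmod (pt i))\<^sup>2) * sqrt (1 - (cmod (pt j))\<^sup>2)
        * cmod (1 / (1 - cnj (pt i) * pt j))"
    unfolding unit_szego_def cinner_scaleC_left cinner_scaleC_right
      cinner_szego_szego[OF pt_in_ball pt_in_ball]
    by (simp only: complex_cnj_complex_of_real norm_mult norm_of_real abs_of_nonneg[OF nn] mult_ac)
  also have "cmod (1 / (1 - cnj (pt i) * pt j)) = 1 / (1 - (1 - (t i)\<^sup>2) * (1 - (t j)\<^sup>2))"
  proof -
    have "1 / (1 - cnj (pt i) * pt j) = complex_of_real (1 / (1 - (1 - (t i)\<^sup>2) * (1 - (t j)\<^sup>2)))"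
      by (simp add: pt)
    moreover have "0 < 1 / (1 - (1 - (t i)\<^sup>2) * (1 - (t j)\<^sup>2))"
      using denom_pos by (intro divide_pos_pos) linarith+
    ultimately show ?thesis by (simp only: norm_of_real abs_of_pos)
  qed
  also have "sqrt (1 - (cmod (pt i))\<^sup>2) * sqrt (1 - (cmod (pt j))\<^sup>2)
      * (1 / (1 - (1 - (t i)\<^sup>2) * (1 - (t j)\<^sup>2))) \<le> (2 * t i) * (2 * t j) * (1 / (t i)\<^sup>2)"
  proof (intro mult_mono sq nn)
    show "1 / (1 - (1 - (t i)\<^sup>2) * (1 - (t j)\<^sup>2)) \<le> 1 / (t i)\<^sup>2"
      by (rule divide_left_mono[OF denom zero_le_one mult_pos_pos[OF denom_pos t2(1)]])
    show "0 \<le> 1 / (1 - (1 - (t i)\<^sup>2) * (1 - (t j)\<^sup>2))"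
      using denom_pos by (intro divide_nonneg_pos) linarith+
  qed (use t[of i] t[of j] in auto)
  also have "\<dots> = 4 * t j / t i"
    using t[of i] by (simp add: field_simps power2_eq_square)
  also have "\<dots> \<le> 4 * (t i * (1 / 2) ^ (i + j + 4)) / t i"
    using pt_decay[OF assms, folded t_def] t[of i]
    by (intro divide_right_mono mult_left_mono) auto
  also have "\<dots> = (1 / 2) ^ (i + 1) * (1 / 2) ^ (j + 1)"
    using t[of i] by (simp add: power_add power_divide)
  finally show ?thesis .
qed

lemma cinner_unit_pt:
  assumes "i \<noteq> j"
  shows "cmod (cinner (unit_szego (pt i)) (unit_szego (pt j))) \<le> (1 / 2) ^ (i + 1) * (1 / 2) ^ (j + 1)"
proof (cases "i < j")
  case False
  then show ?thesis
    using cinner_unit_pt_less[of j i] assms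
    by (subst cinner_cnj) (simp add: mult.commute)
qed (rule cinner_unit_pt_less)

lemma sum_delta:
  assumes "finite F"
  shows "(\<Sum>i\<in>F. ((1 / 2 :: real) ^ (i + 1))\<^sup>2) \<le> 1 / 2"
proof -
  have "(\<lambda>i. 1 / 4 * (1 / 4 :: real) ^ i) sums (1 / 4 * (1 / (1 - 1 / 4)))"
    by (intro sums_mult geometric_sums) simp
  moreover have "1 / 4 * (1 / 4 :: real) ^ i = ((1 / 2) ^ (i + 1))\<^sup>2" for i
    by (simp add: power2_eq_square power_add flip: power_mult_distrib)
  ultimately have *: "(\<lambda>i. ((1 / 2 :: real) ^ (i + 1))\<^sup>2) sums (1 / 3)" by simp
  show ?thesis
    using sum_le_suminf[OF sums_summable[OF *] assms] sums_unique[OF *] by simp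
qed

lemma unit_pt_bounds:
  assumes "finite F"
  shows "(norm (\<Sum>i\<in>F. b i *\<^sub>C unit_szego (pt i)))\<^sup>2 \<le> 3 / 2 * (\<Sum>i\<in>F. (cmod (b i))\<^sup>2)"
    and "(\<Sum>i\<in>F. (cmod (b i))\<^sup>2) \<le> 2 * (norm (\<Sum>i\<in>F. b i *\<^sub>C unit_szego (pt i)))\<^sup>2"
  using almost_orthonormal[OF assms norm_unit_szego[OF pt_in_ball] cinner_unit_pt sum_delta[OF assms], of b]
  by linarith+

lemma inj_pt: "inj pt"
proof (rule injI, rule ccontr)
  fix i j assume *: "pt i = pt j" "i \<noteq> j"
  have "cmod (cinner (unit_szego (pt i)) (unit_szego (pt j))) = 1"
    using * norm_unit_szego[OF pt_in_ball] by (simp add: cinner_self)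
  moreover have "(1 / 2 :: real) ^ (i + 1) * (1 / 2) ^ (j + 1) = 1 / 4 * (1 / 2) ^ (i + j)"
    by (simp add: power_add)
  moreover have "(1 / 2 :: real) ^ (i + j) \<le> 1" by (rule power_le_one) auto
  ultimately show False using cinner_unit_pt[OF *(2)] by linarith
qed

section \<open>Bessel systems of spans of kernels\<close>

text \<open>
  Square bounds on finite subsums give an unconditional Cauchy criterion: beyond a finite
  set that carries almost all of the mass of \<open>g\<close>, finite subsums of \<open>f\<close> are small.
\<close>

lemma summable_on_sq_bound:
  fixes f :: "'i \<Rightarrow> 'b :: banach" and g :: "'i \<Rightarrow> real"
  assumes g: "g summable_on A" and nonneg: "\<And>x. x \<in> A \<Longrightarrow> 0 \<le> g x" and "0 \<le> K"
    and bound: "\<And>F. finite F \<Longrightarrow> F \<subseteq> A \<Longrightarrow> (norm (sum f F))\<^sup>2 \<le> K * sum g F"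
  shows "f summable_on A" and "(norm (infsum f A))\<^sup>2 \<le> K * infsum g A"
proof -
  have "cauchy_filter (filtermap (sum f) (finite_subsets_at_top A))"
    unfolding cauchy_filter_metric_filtermap
  proof (intro allI impI)
    fix \<epsilon> :: real assume "0 < \<epsilon>"
    \<comment> \<open>adding 1 to \<open>K\<close> keeps the denominator positive for \<open>K = 0\<close>\<close>
    define d where "d = (\<epsilon> / 4)\<^sup>2 / (K + 1)"
    have d: "0 < d" "K * d \<le> (\<epsilon> / 4)\<^sup>2" 
      using \<open>0 < \<epsilon>\<close> \<open>0 \<le> K\<close> by (auto simp: d_def field_simps)
    obtain F0 where F0: "finite F0" "F0 \<subseteq> A" "dist (sum g F0) (infsum g A) \<le> d"
      using infsum_finite_approximation[OF g d(1)] by blast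
    have close: "dist (sum f F) (sum f F0) \<le> \<epsilon> / 4" if F: "finite F" "F0 \<subseteq> F" "F \<subseteq> A" for F
    proof -
      have "sum g F \<le> infsum g A"
        using F by (intro finite_sum_le_infsum[OF g] nonneg) auto
      then have "sum g (F - F0) \<le> d"
        using F0(3) F by (simp add: sum_diff dist_real_def)
      have "(norm (sum f (F - F0)))\<^sup>2 \<le> K * sum g (F - F0)"
        using F by (intro bound) auto
      also have "\<dots> \<le> K * d"
        using \<open>sum g (F - F0) \<le> d\<close> \<open>0 \<le> K\<close> by (rule mult_left_mono)
      also have "\<dots> \<le> (\<epsilon> / 4)\<^sup>2" by (rule d(2))
      finally have "norm (sum f (F - F0)) \<le> \<epsilon> / 4"
        using \<open>0 < \<epsilon>\<close> by (simp add: power2_le_iff_abs_le)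
      then show ?thesis using F by (simp add: sum_diff dist_norm)
    qed
    show "\<exists>P. eventually P (finite_subsets_at_top A)
        \<and> (\<forall>F G. P F \<and> P G \<longrightarrow> dist (sum f F) (sum f G) < \<epsilon>)"
    proof (intro exI conjI allI impI)
      show "eventually (\<lambda>F. finite F \<and> F0 \<subseteq> F \<and> F \<subseteq> A) (finite_subsets_at_top A)"
        using F0 by (auto simp: eventually_finite_subsets_at_top)
      fix F G assume "(finite F \<and> F0 \<subseteq> F \<and> F \<subseteq> A) \<and> (finite G \<and> F0 \<subseteq> G \<and> G \<subseteq> A)"
      then have "dist (sum f F) (sum f F0) \<le> \<epsilon> / 4" "dist (sum f G) (sum f F0) \<le> \<epsilon> / 4"
        using close by auto
      then show "dist (sum f F) (sum f G) < \<epsilon>"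
        using dist_triangle2[of "sum f F" "sum f G" "sum f F0"] \<open>0 < \<epsilon>\<close> by linarith
    qed
  qed
  moreover have "complete (UNIV :: 'b set)"
    by (meson Cauchy_convergent UNIV_I complete_def convergent_def)
  ultimately obtain L where "(sum f \<longlongrightarrow> L) (finite_subsets_at_top A)"
    using complete_uniform[where S=UNIV] by (force simp add: filterlim_def)
  then show summable: "f summable_on A"
    using summable_on_def has_sum_def by blast
  show "(norm (infsum f A))\<^sup>2 \<le> K * infsum g A"
  proof (rule tendsto_upperbound)
    show "((\<lambda>F. (norm (sum f F))\<^sup>2) \<longlongrightarrow> (norm (infsum f A))\<^sup>2) (finite_subsets_at_top A)"
      by (intro tendsto_intros infsum_tendsto summable)
    show "\<forall>\<^sub>F F in finite_subsets_at_top A. (norm (sum f F))\<^sup>2 \<le> K * infsum g A"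
    proof (rule eventually_finite_subsets_at_top_weakI)
      fix F assume F: "finite F" "F \<subseteq> A"
      then have "sum g F \<le> infsum g A" by (intro finite_sum_le_infsum[OF g] nonneg) auto
      then show "(norm (sum f F))\<^sup>2 \<le> K * infsum g A"
        using bound[OF F] mult_left_mono[OF _ \<open>0 \<le> K\<close>] by fastforce
    qed
  qed simp
qed

text \<open>
  Collecting the coefficients of each kernel gives a sum of at most \<open>M\<close> terms at every point, so
  the Cauchy--Schwarz inequality loses a factor \<open>M\<close>. The upper and the lower bound for
  combinations of kernels contribute \<open>3 / 2\<close> and \<open>2\<close>.
\<close>

lemma finite_overlap_bound:
  fixes h :: "'i \<Rightarrow> hardy"
  assumes "finite N" and E: "\<And>n. n \<in> N \<Longrightarrow> finite (E n)"
    and overlap: "\<And>p. card {n \<in> N. p \<in> E n} \<le> M"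
    and h: "\<And>n. n \<in> N \<Longrightarrow> h n = (\<Sum>p\<in>E n. c n p *\<^sub>C unit_szego (pt p))"
    and norm: "\<And>n. n \<in> N \<Longrightarrow> norm (h n) = 1"
  shows "(norm (\<Sum>n\<in>N. a n *\<^sub>C h n))\<^sup>2 \<le> 3 * real M * (\<Sum>n\<in>N. (cmod (a n))\<^sup>2)"
proof -
  define F where "F = (\<Union>n\<in>N. E n)"
  have F: "finite F" using assms(1) E by (auto simp: F_def)
  define c' where "c' n p = (if p \<in> E n then c n p else 0)" for n p
  have h': "h n = (\<Sum>p\<in>F. c' n p *\<^sub>C unit_szego (pt p))" if "n \<in> N" for n
    unfolding h[OF that] c'_def
    by (rule sum.mono_neutral_cong_left) (use F that in \<open>auto simp: F_def scaleC_simps\<close>)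
  have "(\<Sum>n\<in>N. a n *\<^sub>C h n) = (\<Sum>p\<in>F. (\<Sum>n\<in>N. a n * c' n p) *\<^sub>C unit_szego (pt p))"
    by (simp add: h' scaleC_sum_right scaleC_sum_left scaleC_simps) (rule sum.swap)
  then have "(norm (\<Sum>n\<in>N. a n *\<^sub>C h n))\<^sup>2 \<le> 3 / 2 * (\<Sum>p\<in>F. (cmod (\<Sum>n\<in>N. a n * c' n p))\<^sup>2)"
    using unit_pt_bounds(1)[OF F] by simp
  also have "\<dots> \<le> 3 / 2 * (\<Sum>p\<in>F. M * (\<Sum>n\<in>N. (cmod (a n) * cmod (c' n p))\<^sup>2))"
  proof (intro mult_left_mono sum_mono)
    fix p
    let ?N = "{n \<in> N. p \<in> E n}"
    have "cmod (\<Sum>n\<in>N. a n * c' n p) \<le> (\<Sum>n\<in>N. cmod (a n) * cmod (c' n p))"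
      by (rule sum_norm_le) (simp add: norm_mult)
    also have "\<dots> = (\<Sum>n\<in>?N. cmod (a n) * cmod (c' n p))"
      by (rule sum.mono_neutral_right) (use assms(1) in \<open>auto simp: c'_def\<close>)
    finally have "(cmod (\<Sum>n\<in>N. a n * c' n p))\<^sup>2 \<le> (\<Sum>n\<in>?N. cmod (a n) * cmod (c' n p))\<^sup>2"
      by (intro power_mono) auto
    also have "\<dots> \<le> (\<Sum>n\<in>?N. (cmod (a n) * cmod (c' n p))\<^sup>2) * card ?N"
      by (rule sum_squared_le_sum_of_squares)
    also have "\<dots> \<le> (\<Sum>n\<in>N. (cmod (a n) * cmod (c' n p))\<^sup>2) * M"
      using overlap[of p] assms(1)
      by (intro mult_mono sum_mono2) (auto intro: sum_nonneg)
    finally show "(cmod (\<Sum>n\<in>N. a n * c' n p))\<^sup>2 \<le> M * (\<Sum>n\<in>N. (cmod (a n) * cmod (c' n p))\<^sup>2)"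
      by (simp add: mult.commute)
  qed simp
  also have "\<dots> = 3 / 2 * M * (\<Sum>n\<in>N. (cmod (a n))\<^sup>2 * (\<Sum>p\<in>F. (cmod (c' n p))\<^sup>2))"
    by (simp add: sum_distrib_left power_mult_distrib mult_ac) (rule sum.swap)
  also have "\<dots> \<le> 3 / 2 * M * (\<Sum>n\<in>N. (cmod (a n))\<^sup>2 * 2)"
  proof (intro mult_left_mono sum_mono)
    fix n assume "n \<in> N"
    then show "(\<Sum>p\<in>F. (cmod (c' n p))\<^sup>2) \<le> 2"
      using unit_pt_bounds(2)[OF F, of "c' n"] h' norm by simp
  qed auto
  finally show ?thesis by (simp add: sum_distrib_right[symmetric])
qed

lemma bessel_system_finite_overlap:
  fixes H :: "'i \<Rightarrow> hardy set"
  assumes E: "\<And>n. n \<in> I \<Longrightarrow> finite (E n)"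
    and fin: "\<And>p. finite {n \<in> I. p \<in> E n}" and overlap: "\<And>p. card {n \<in> I. p \<in> E n} \<le> M"
    and H: "\<And>n. n \<in> I \<Longrightarrow> H n \<subseteq> {\<Sum>p\<in>E n. c p *\<^sub>C unit_szego (pt p) | c. True}"
  shows "bessel_system I H"
  unfolding bessel_system_def
proof (intro exI conjI allI impI)
  let ?C = "1 + 3 * real M"
  show "1 \<le> ?C" by simp
  fix h :: "'i \<Rightarrow> hardy" and a :: "'i \<Rightarrow> complex"
  assume h: "\<forall>n\<in>I. h n \<in> H n \<and> norm (h n) = 1" and a: "(\<lambda>n. (cmod (a n))\<^sup>2) summable_on I"
  have "\<forall>n\<in>I. \<exists>c. h n = (\<Sum>p\<in>E n. c p *\<^sub>C unit_szego (pt p))" using H h by blast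
  then obtain c where c: "\<And>n. n \<in> I \<Longrightarrow> h n = (\<Sum>p\<in>E n. c n p *\<^sub>C unit_szego (pt p))" by metis
  have bound: "(norm (\<Sum>n\<in>N. a n *\<^sub>C h n))\<^sup>2 \<le> ?C\<^sup>2 * (\<Sum>n\<in>N. (cmod (a n))\<^sup>2)"
    if N: "finite N" "N \<subseteq> I" for N
  proof -
    have "card {n \<in> N. p \<in> E n} \<le> M" for p
      using overlap[of p] card_mono[OF fin[of p], of "{n \<in> N. p \<in> E n}"] N(2) by force
    then have "(norm (\<Sum>n\<in>N. a n *\<^sub>C h n))\<^sup>2 \<le> 3 * real M * (\<Sum>n\<in>N. (cmod (a n))\<^sup>2)"
      using N E c h by (intro finite_overlap_bound[where E = E and c = c]) auto
    also have "\<dots> \<le> ?C\<^sup>2 * (\<Sum>n\<in>N. (cmod (a n))\<^sup>2)"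
      by (intro mult_right_mono sum_nonneg) (auto simp: power2_eq_square algebra_simps)
    finally show ?thesis .
  qed
  show "(\<lambda>n. a n *\<^sub>C h n) summable_on I"
    and "(norm (\<Sum>\<^sub>\<infinity>n\<in>I. a n *\<^sub>C h n))\<^sup>2 \<le> ?C\<^sup>2 * (\<Sum>\<^sub>\<infinity>n\<in>I. (cmod (a n))\<^sup>2)"
    by (rule summable_on_sq_bound[OF a _ _ bound]; simp)+
qed

section \<open>Subspaces with a common vector\<close>

lemma not_weakly_separated_common_vector:
  assumes "n \<in> I" "j \<in> I" "n \<noteq> j" "x \<in> H n" "x \<in> H j" "x \<noteq> 0"
  shows "\<not> weakly_separated I H"
proof -
  have "cmod (cinner x x) = norm x * norm x"
    unfolding cinner_self norm_of_real by (simp add: power2_eq_square)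
  then have "vec_angle x x = 0"
    using assms(6) by (simp add: vec_angle_def)
  then have "0 \<in> {sin (vec_angle x y) | x y. x \<in> H n \<and> x \<noteq> 0 \<and> y \<in> H j \<and> y \<noteq> 0}"
    using assms by (intro CollectI exI[of _ x]) auto
  then have "sin_between (H n) (H j) \<le> 0"
    unfolding sin_between_def by (rule cInf_lower) (auto intro!: bdd_belowI[of _ "-1"])
  then have "(INF (n, j)\<in>{(n, j). n \<in> I \<and> j \<in> I \<and> n \<noteq> j}. ereal (sin_between (H n) (H j))) \<le> 0"
    using assms by (intro INF_lower2[of "(n, j)"]) auto
  then show ?thesis by (simp add: weakly_separated_def not_less)
qed

text \<open>
  Taking the common unit vector \<open>x\<close> from both spaces, the combination \<open>x - x = 0\<close> violates the
  lower Riesz bound. The definition speaks only of choices of unit vectors from all members of the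
  family, so the remaining members need one as well.
\<close>

lemma not_riesz_system_common_vector:
  assumes nj: "n \<in> I" "j \<in> I" "n \<noteq> j" and x: "x \<in> H n" "x \<in> H j" "norm x = 1"
    and unit: "\<And>m. m \<in> I \<Longrightarrow> \<exists>y\<in>H m. norm y = 1"
  shows "\<not> riesz_system I H"
proof
  assume "riesz_system I H"
  then obtain C where C: "1 \<le> C" and riesz: "\<And>h a.
     (\<forall>n\<in>I. h n \<in> H n \<and> norm (h n) = 1) \<Longrightarrow> (\<lambda>n. (cmod (a n))\<^sup>2) summable_on I \<Longrightarrow>
     1 / C\<^sup>2 * (\<Sum>\<^sub>\<infinity>n\<in>I. (cmod (a n))\<^sup>2) \<le> (norm (\<Sum>\<^sub>\<infinity>n\<in>I. a n *\<^sub>C h n))\<^sup>2"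
    unfolding riesz_system_def by blast
  obtain y where y: "\<And>m. m \<in> I \<Longrightarrow> y m \<in> H m \<and> norm (y m) = 1" using unit by metis
  define h where "h m = (if m = n \<or> m = j then x else y m)" for m
  define a :: "'a \<Rightarrow> complex" where "a m = (if m = n then 1 else if m = j then - 1 else 0)" for m
  have sub: "{n, j} \<subseteq> I" using nj by simp
  have "(\<lambda>m. (cmod (a m))\<^sup>2) summable_on {n, j}" by simp
  then have sum: "(\<lambda>m. (cmod (a m))\<^sup>2) summable_on I"
    by (rule summable_on_cong_neutral[THEN iffD1, rotated -1]) (use sub in \<open>auto simp: a_def\<close>)
  have "(\<Sum>\<^sub>\<infinity>m\<in>I. (cmod (a m))\<^sup>2) = (\<Sum>\<^sub>\<infinity>m\<in>{n, j}. (cmod (a m))\<^sup>2)"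
    by (rule infsum_cong_neutral) (use sub in \<open>auto simp: a_def\<close>)
  then have sq: "(\<Sum>\<^sub>\<infinity>m\<in>I. (cmod (a m))\<^sup>2) = 2" using nj by (simp add: a_def)
  have "(\<Sum>\<^sub>\<infinity>m\<in>I. a m *\<^sub>C h m) = (\<Sum>\<^sub>\<infinity>m\<in>{n, j}. a m *\<^sub>C h m)"
    by (rule infsum_cong_neutral) (use sub in \<open>auto simp: a_def scaleC_simps\<close>)
  also have "\<dots> = 0" using nj scaleC_simps(2)[of 1 "- 1" x]
    by (simp add: a_def h_def scaleC_simps)
  finally have zero: "(\<Sum>\<^sub>\<infinity>m\<in>I. a m *\<^sub>C h m) = 0" .
  have "\<forall>m\<in>I. h m \<in> H m \<and> norm (h m) = 1"
    using x y by (auto simp: h_def)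
  from riesz[OF this sum] have "1 / C\<^sup>2 * 2 \<le> (norm (0 :: hardy))\<^sup>2"
    unfolding sq zero .
  then show False using C by simp
qed

section \<open>Edges of a union of growing complete graphs\<close>

text \<open>
  The vertices are pairs of natural numbers and the components are the antidiagonals
  \<open>x + y = s\<close>, which have \<open>s + 1\<close> elements.
\<close>

definition block :: "nat \<Rightarrow> nat" where
  "block n = fst (prod_decode n) + snd (prod_decode n)"

text \<open>
  Both directions of an edge and the loop at each vertex are included; the loop makes
  \<open>edges n\<close> nonempty, also for the component with a single vertex.
\<close>

definition edges :: "nat \<Rightarrow> nat set" where
  "edges n = {p. \<exists>m. block m = block n \<and> (p = prod_encode (n, m) \<or> p = prod_encode (m, n))}"

lemma finite_block: "finite {m. block m = s}"
proof (rule finite_subset)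
  show "{m. block m = s} \<subseteq> prod_encode ` ({..s} \<times> {..s})"
  proof
    fix m assume "m \<in> {m. block m = s}"
    then show "m \<in> prod_encode ` ({..s} \<times> {..s})"
      by (intro image_eqI[of _ _ "prod_decode m"]) (auto simp: block_def mem_Times_iff)
  qed
qed auto

lemma finite_edges: "finite (edges n)"
proof (rule finite_subset)
  show "edges n \<subseteq> (\<lambda>m. prod_encode (n, m)) ` {m. block m = block n}
      \<union> (\<lambda>m. prod_encode (m, n)) ` {m. block m = block n}"
    by (auto simp: edges_def)
qed (simp add: finite_block)

lemma edges_overlap: "{n. p \<in> edges n} \<subseteq> {fst (prod_decode p), snd (prod_decode p)}"
  by (auto simp: edges_def)

lemma finite_cover_block:
  assumes "finite \<I>" "\<Union>\<I> = UNIV"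
  obtains I n m where "I \<in> \<I>" "n \<in> I" "m \<in> I" "n \<noteq> m" "block n = block m"
proof -
  \<comment> \<open>the antidiagonal \<open>x + y = s\<close> has one vertex more than there are cells\<close>
  define s where "s = card \<I>"
  define v where "v x = prod_encode (x, s - x)" for x
  have "\<forall>x. \<exists>I\<in>\<I>. v x \<in> I" using assms(2) by blast
  then obtain f where f: "\<And>x. f x \<in> \<I> \<and> v x \<in> f x" by metis
  have "card (f ` {..s}) \<le> s"
    unfolding s_def using f assms(1) by (intro card_mono) auto
  then have "\<not> inj_on f {..s}" by (intro pigeonhole) simp
  then obtain x y where xy: "x \<le> s" "y \<le> s" "x \<noteq> y" "f x = f y" by (auto simp: inj_on_def)
  show thesis
  proof (rule that[of "f x" "v x" "v y"])
    show "v x \<noteq> v y" "block (v x) = block (v y)"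
      using xy by (simp_all add: v_def block_def)
  qed (use f xy in \<open>metis+\<close>)
qed

theorem mainTheorem3:
  "\<exists>A :: nat \<Rightarrow> complex mat.
     (\<forall>n. square_mat (A n) \<and> 0 < dim_row (A n) \<and> spectrum (A n) \<subseteq> ball 0 1) \<and>
     (\<forall>n. is_model_space (matrix_space (A n))) \<and>
     bessel_system UNIV (\<lambda>n. matrix_space (A n)) \<and>
     \<not> finite_disjoint_union weakly_separated (\<lambda>n. matrix_space (A n)) \<and>
     \<not> finite_disjoint_union riesz_system (\<lambda>n. matrix_space (A n))"
proof -
  define \<Lambda> where "\<Lambda> n = pt ` edges n" for n
  have \<Lambda>: "finite (\<Lambda> n)" "\<Lambda> n \<noteq> {}" "\<Lambda> n \<subseteq> ball 0 1" for n
    using pt_in_ball finite_edges by (auto simp: \<Lambda>_def edges_def)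
  have "\<forall>n. \<exists>A. square_mat A \<and> 0 < dim_row A \<and> spectrum A = \<Lambda> n
      \<and> matrix_space A = orth_compl (vanishing (\<Lambda> n))"
    using ex_matrix_space[OF \<Lambda>] by blast
  then obtain A where A: "\<And>n. square_mat (A n) \<and> 0 < dim_row (A n) \<and> spectrum (A n) = \<Lambda> n
      \<and> matrix_space (A n) = orth_compl (vanishing (\<Lambda> n))"
    by metis
  define H where "H n = matrix_space (A n)" for n
  have H: "H n = {\<Sum>w\<in>\<Lambda> n. c w *\<^sub>C szego w | c. True}" for n
    using A orth_compl_vanishing[OF \<Lambda>(1,3)] by (simp add: H_def)
  have mem: "unit_szego (pt p) \<in> H n" if "p \<in> edges n" for n p
  proof -
    define c where "c w = (if w = pt p then complex_of_real (sqrt (1 - (cmod w)\<^sup>2)) else 0)" for w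
    have "unit_szego (pt p) = (\<Sum>w\<in>\<Lambda> n. c w *\<^sub>C szego w)"
      using that \<Lambda>(1)[of n]
      by (subst sum.remove[of _ "pt p"]) (auto simp: c_def \<Lambda>_def unit_szego_def scaleC_simps intro!: sum.neutral)
    then show ?thesis unfolding H by blast
  qed
  have bessel: "bessel_system UNIV H"
  proof (rule bessel_system_finite_overlap[where E = edges and M = 2])
    show "finite {n \<in> UNIV. p \<in> edges n}" for p
      using finite_subset[OF edges_overlap] by simp
    show "card {n \<in> UNIV. p \<in> edges n} \<le> 2" for p
      using card_mono[OF _ edges_overlap[of p]] card_insert_le_m1[of 2 "{snd (prod_decode p)}" "fst (prod_decode p)"]
      by simp
    fix n
    show "H n \<subseteq> {\<Sum>p\<in>edges n. c p *\<^sub>C unit_szego (pt p) | c. True}"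
    proof
      fix h assume "h \<in> H n"
      then obtain c where h: "h = (\<Sum>w\<in>\<Lambda> n. c w *\<^sub>C szego w)" using H by auto
      define c' where "c' p = c (pt p) / complex_of_real (sqrt (1 - (cmod (pt p))\<^sup>2))" for p
      have "szego w = (1 / complex_of_real (sqrt (1 - (cmod w)\<^sup>2))) *\<^sub>C unit_szego w"
        if "w \<in> ball 0 1" for w
        using that norm_unit_szego[OF that]
        by (auto simp: unit_szego_def scaleC_simps)
      then have "h = (\<Sum>w\<in>\<Lambda> n. (c w / complex_of_real (sqrt (1 - (cmod w)\<^sup>2))) *\<^sub>C unit_szego w)"
        unfolding h using \<Lambda>(3)[of n] by (intro sum.cong) (auto simp: scaleC_simps subset_iff)
      also have "\<dots> = (\<Sum>p\<in>edges n. c' p *\<^sub>C unit_szego (pt p))"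
        unfolding c'_def \<Lambda>_def by (subst sum.reindex) (auto intro: inj_on_subset[OF inj_pt])
      finally show "h \<in> {\<Sum>p\<in>edges n. c p *\<^sub>C unit_szego (pt p) | c. True}" by blast
    qed
  qed (rule finite_edges)
  have common: "\<exists>I\<in>\<I>. \<not> weakly_separated I H \<and> \<not> riesz_system I H"
    if fin: "finite \<I>" and part: "partition_on UNIV \<I>" for \<I>
  proof -
    obtain I n m where I: "I \<in> \<I>" "n \<in> I" "m \<in> I" "n \<noteq> m" "block n = block m"
      by (rule finite_cover_block[OF fin partition_onD1[OF part, symmetric]])
    let ?x = "unit_szego (pt (prod_encode (n, m)))"
    have x: "?x \<in> H n" "?x \<in> H m" "norm ?x = 1"
      using I(5) by (auto intro!: mem norm_unit_szego pt_in_ball simp: edges_def)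
    have "\<exists>y\<in>H k. norm y = 1" for k
      by (rule bexI[of _ "unit_szego (pt (prod_encode (k, k)))"])
        (auto intro!: mem norm_unit_szego pt_in_ball simp: edges_def)
    moreover have "?x \<noteq> 0" using x(3) by auto
    ultimately show ?thesis
      using I x not_weakly_separated_common_vector[of n I m ?x H]
        not_riesz_system_common_vector[of n I m ?x H] by blast
  qed
  show ?thesis
  proof (intro exI[of _ A] conjI)
    show "\<forall>n. square_mat (A n) \<and> 0 < dim_row (A n) \<and> spectrum (A n) \<subseteq> ball 0 1"
      using A \<Lambda>(3) by metis
    show "\<forall>n. is_model_space (matrix_space (A n))"
      using A is_model_space_vanishing[OF \<Lambda>(1,3)] by simp
    show "bessel_system UNIV (\<lambda>n. matrix_space (A n))"
      using bessel by (simp add: H_def[abs_def])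
    show "\<not> finite_disjoint_union weakly_separated (\<lambda>n. matrix_space (A n))"
      "\<not> finite_disjoint_union riesz_system (\<lambda>n. matrix_space (A n))"
      using common unfolding finite_disjoint_union_def H_def[abs_def] by blast+
  qed
qed


end
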